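(* Let $n,p,n',p'$ be real numbers with $0<p<n/2$ and $0<p'<n'/2$. For the two matrix weights $W=W_{p,n}$ and $W'=W_{p',n'}$, the algebras $\mathcal D(W)$ and $\mathcal D(W')$ are isomorphic.
   Context: Weight: for real $0<p<n/2$, $$W_{p,n}(x)=(1-x^2)^{\frac n2-1}\begin{pmatrix} p\,x^2+n-p & -nx\\ -nx & (n-p)x^2+p\end{pmatrix},\quad x\in[-1,1].$$ $M_2$ denotes complex $2\times2$ matrices, $T^*$ the conjugate transpose. For such a weight $W$, on $M_2[x]$ use the matrix-valued form $(P,Q)=\int_{-1}^1 P(x)W(x)Q(x)^*\,dx$; $\{Q_w\}_{w\ge0}$ is the unique sequence of monic orthogonal polynomials ($Q_w\in M_2[x]$ monic of degree $w$, $(Q_w,Q_{w'})=0$ for $w\neq w'$). Differential operators $D=\sum_{i=0}^s\partial^iF_i$, $\partial=\frac{d}{dx}$, $F_i\in M_2[x]$, act on the right: $PD=\sum_i \partial^i(P)\,F_i$; the product satisfies $P(DE)=(PD)E$. $$\mathcal D(W)=\{D:\ Q_wD=\Lambda_w(D)Q_w \text{ for some }\Lambda_w(D)\in M_2,\ \text{for all } w\ge0\},$$ an associative unital algebra over $\mathbb C$. (The coefficients of any such $D$ are automatically polynomials with $\deg F_i\le i$.) Isomorphic means isomorphic as $\mathbb C$-algebras. *)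

theory Defs
  imports "HOL-Analysis.Analysis" "HOL-Algebra.QuotRing" "HOL-Algebra.Module"
begin

text \<open>
  \<open>M\<^sub>2[x]\<close> is represented by 2 x 2 matrices with entries in \<open>\<complex>[x]\<close>; then \<open>(**)\<close> is the product of
  \<open>M\<^sub>2[x]\<close>, whereas \<open>(*)\<close> on vectors would be the componentwise product.
\<close>

type_synonym cmat = "complex^2^2"
type_synonym cmat_poly = "complex poly^2^2"

definition const_mpoly :: "cmat \<Rightarrow> cmat_poly" where
  "const_mpoly A = map_matrix (\<lambda>c. [:c:]) A"

definition coeff_mpoly :: "cmat_poly \<Rightarrow> nat \<Rightarrow> cmat" where
  "coeff_mpoly P k = map_matrix (\<lambda>q. coeff q k) P"

definition eval_mpoly :: "cmat_poly \<Rightarrow> real \<Rightarrow> cmat" where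
  "eval_mpoly P x = map_matrix (\<lambda>q. poly q (complex_of_real x)) P"

definition smult_mpoly :: "complex \<Rightarrow> cmat_poly \<Rightarrow> cmat_poly" where
  "smult_mpoly c P = map_matrix (Polynomial.smult c) P"

definition deriv_mpoly :: "nat \<Rightarrow> cmat_poly \<Rightarrow> cmat_poly" where
  "deriv_mpoly i P = map_matrix (pderiv ^^ i) P"

definition monic_mpoly :: "nat \<Rightarrow> cmat_poly \<Rightarrow> bool" where
  "monic_mpoly w P \<longleftrightarrow> coeff_mpoly P w = mat 1 \<and> (\<forall>k>w. coeff_mpoly P k = 0)"

definition conj_transpose :: "cmat \<Rightarrow> cmat" where
  "conj_transpose A = map_matrix cnj (transpose A)"

text \<open>
  At \<open>x = \<plusminus>1\<close> the weight is given the junk value \<open>0 powr a = 0\<close>; this does not affect the integrals.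
\<close>

definition weight :: "real \<Rightarrow> real \<Rightarrow> real \<Rightarrow> cmat" where
  "weight p n x = ((1 - x\<^sup>2) powr (n / 2 - 1)) *\<^sub>R
     vector [vector [complex_of_real (p * x\<^sup>2 + n - p), complex_of_real (- n * x)],
             vector [complex_of_real (- n * x), complex_of_real ((n - p) * x\<^sup>2 + p)]]"

definition mform :: "(real \<Rightarrow> cmat) \<Rightarrow> cmat_poly \<Rightarrow> cmat_poly \<Rightarrow> cmat" where
  "mform W P Q =
     (LBINT x:{-1..1}. eval_mpoly P x ** W x ** conj_transpose (eval_mpoly Q x))"

definition is_monic_orthogonal :: "(real \<Rightarrow> cmat) \<Rightarrow> (nat \<Rightarrow> cmat_poly) \<Rightarrow> bool" where
  "is_monic_orthogonal W Q \<longleftrightarrow>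
     (\<forall>w. monic_mpoly w (Q w)) \<and> (\<forall>w w'. w \<noteq> w' \<longrightarrow> mform W (Q w) (Q w') = 0)"

definition monic_orthogonal :: "(real \<Rightarrow> cmat) \<Rightarrow> nat \<Rightarrow> cmat_poly" where
  "monic_orthogonal W = (THE Q. is_monic_orthogonal W Q)"

text \<open>
  A differential operator is identified with the map \<open>P \<mapsto> PD\<close> on \<open>M\<^sub>2[x]\<close>. This loses nothing,
  since the coefficients can be recovered from the action (lemma \<open>diff_op_coeffs_unique\<close> below).
\<close>

type_synonym mop = "cmat_poly \<Rightarrow> cmat_poly"

definition diff_op :: "nat \<Rightarrow> (nat \<Rightarrow> cmat_poly) \<Rightarrow> mop" where
  "diff_op s F = (\<lambda>P. \<Sum>i\<le>s. deriv_mpoly i P ** F i)"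

definition diff_ops :: "mop set" where
  "diff_ops = {D. \<exists>s F. D = diff_op s F}"

definition D_set :: "(real \<Rightarrow> cmat) \<Rightarrow> mop set" where
  "D_set W = {D \<in> diff_ops. \<forall>w. \<exists>\<Lambda>.
     D (monic_orthogonal W w) = const_mpoly \<Lambda> ** monic_orthogonal W w}"

text \<open>
  Operators act on the right, so the product \<open>D E\<close> applies \<open>D\<close> first: \<open>P(DE) = (PD)E\<close>.
\<close>

definition D_alg :: "(real \<Rightarrow> cmat) \<Rightarrow> (complex, mop) module" where
  "D_alg W = \<lparr>carrier = D_set W,
     monoid.mult = (\<lambda>D E P. E (D P)),
     one = (\<lambda>P. P),
     ring.zero = (\<lambda>P. 0),
     add = (\<lambda>D E P. D P + E P),
     module.smult = (\<lambda>c D P. smult_mpoly c (D P))\<rparr>"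

definition alg_iso :: "('k, 'a, 'm) module_scheme \<Rightarrow> ('k, 'b, 'n) module_scheme \<Rightarrow> ('a \<Rightarrow> 'b) set" where
  "alg_iso A B = {h \<in> ring_iso A B.
     \<forall>c. \<forall>a\<in>carrier A. h (c \<odot>\<^bsub>A\<^esub> a) = c \<odot>\<^bsub>B\<^esub> h a}"

definition alg_isomorphic :: "('k, 'a, 'm) module_scheme \<Rightarrow> ('k, 'b, 'n) module_scheme \<Rightarrow> bool" where
  "alg_isomorphic A B \<longleftrightarrow> alg_iso A B \<noteq> {}"

lemma higher_pderiv_monom_eq:
  "(pderiv ^^ i) (monom (1::complex) m) = (if i \<le> m then monom (fact m / fact (m - i)) (m - i) else 0)"
proof (induction i)
  case 0
  then show ?case by simp
next
  case (Suc i)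
  show ?case
  proof (cases "Suc i \<le> m")
    case True
    then obtain k where k: "m - i = Suc k" "m - Suc i = k" by (metis Suc_diff_Suc Suc_le_lessD)
    show ?thesis using Suc True k by (simp add: pderiv_monom fact_Suc divide_simps del: of_nat_Suc)
  next
    case False
    then show ?thesis using Suc by (cases "i = m") (auto simp: pderiv_monom)
  qed
qed

lemma diff_op_coeffs_unique:
  assumes "diff_op s F = diff_op s G" and "i \<le> s"
  shows "F i = G i"
  using \<open>i \<le> s\<close>
proof (induction i rule: less_induct)
  case (less i)
  let ?P = "mat (monom 1 i) :: cmat_poly"
  have d: "deriv_mpoly j ?P = mat ((pderiv ^^ j) (monom 1 i))" for j
    by (simp add: deriv_mpoly_def mat_def vec_eq_iff)
  have diag: "mat c ** A = map_matrix ((*) c) A" for c and A :: cmat_poly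
    by (simp add: mat_def matrix_matrix_mult_def vec_eq_iff if_distrib if_distribR cong: if_cong)
  have e: "(\<Sum>j\<le>s. deriv_mpoly j ?P ** F j) = (\<Sum>j\<le>s. deriv_mpoly j ?P ** G j)"
    using fun_cong[OF assms(1), of ?P] by (simp add: diff_op_def)
  have split: "(\<Sum>j\<le>s. deriv_mpoly j ?P ** H j) =
      deriv_mpoly i ?P ** H i + (\<Sum>j<i. deriv_mpoly j ?P ** H j)" for H
  proof -
    have "(\<Sum>j\<le>s. deriv_mpoly j ?P ** H j) = (\<Sum>j\<le>i. deriv_mpoly j ?P ** H j)"
      using less.prems
      by (intro sum.mono_neutral_right)
         (auto simp: d diag higher_pderiv_monom_eq vec_eq_iff)
    then show ?thesis by (simp add: lessThan_Suc_atMost[symmetric] add.commute)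
  qed
  have l: "(\<Sum>j<i. deriv_mpoly j ?P ** F j) = (\<Sum>j<i. deriv_mpoly j ?P ** G j)"
    using less by (intro sum.cong) auto
  have "deriv_mpoly i ?P ** F i = deriv_mpoly i ?P ** G i"
    using e unfolding split l by simp
  then have "map_matrix ((*) [:fact i:]) (F i) = map_matrix ((*) [:fact i:]) (G i)"
    by (simp only: d diag higher_pderiv_monom_eq) (simp add: monom_0)
  then have "[:fact i:] * (F i $ a $ b) = [:fact i:] * (G i $ a $ b)" for a b
    by (simp only: vec_eq_iff nth_map_matrix)
  then have "F i $ a $ b = G i $ a $ b" for a b
    by (metis fact_nonzero mult_left_cancel pCons_eq_0_iff)
  then show ?case by (simp add: vec_eq_iff)
qed

end

(*
  Write q = n - p, and let y_w be the monic Gegenbauer polynomial with weight (1 - x^2)^(n/2). Up to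
  the normalising factors w + p and w + q of the two rows, Q_w is the matrix N_w with rows
  (p y + x y', y') and (y', q y + x y'). In terms of t = (w + p + 1)(w + q) / (q - p), the map
  taking D to its eigenvalue on N_w identifies the algebra D(W) with the matrices M in M_2(C[t]) with
  M_11(1) = M_22(0), M_12(1) = 0 and M_21(0) = 0, an algebra in which n and p no longer occur.

  The eigenvalue is polynomial in t because all derivatives of y_w at x = 1 and at x = -1 are
  polynomials in t times y_w(1) and y_w(-1). The three conditions come from the coefficients of x^w and
  x^(w-1) in N_w D, which are polynomials in w and can therefore be evaluated at w = -p and w = -q.
  Conversely, a first-order operator sends N_w to a diagonal matrix times y_w, another sends
  y_w to N_w, and every polynomial in t is realised on y_w by the Gegenbauer operator.
*)

theory Submission
  imports Defs
begin

text \<open>The points w = -p and w = -q are those where the leading coefficient diag(w + p, w + q)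
  of N_w is singular. A relation between coefficients in which such a factor stands on one side only
  becomes, at that point, a condition on M. The coefficient of x^(w-1) couples w with w - 1; since t
  = 1 at w = -p and t = 0 at w = -p - 1, it links M_11(1) with M_22(0). The normalisation of t
  reflects the twin factorisations (q - p) t = (w + p + 1)(w + q) and (q - p)(t - 1) = (w + p)(w + q
  + 1); it requires p and q to differ, which is p < n/2.

  The conditions say that M is a scalar plus diag(t - 1, t) C with C arbitrary. Passing from N_w to
  y_w and back costs exactly the factor (q - p) diag(t - 1, t). In between stands the scalar matrix
  y_w, on which right multiplication by a matrix unit equals left multiplication, so every C occurs.

  The weight matters only for identifying Q_w, a definite description, so uniqueness is needed
  besides orthogonality. Eigenvalues are taken on N_w because conjugation by the row factors would
  spoil their polynomial dependence on t.\<close>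

section \<open>Gegenbauer polynomials\<close>

text \<open>
  \<open>geg w m\<close> is the monic multiple of the Gegenbauer polynomial of degree \<open>w\<close> and parameter \<open>(m + 1) / 2\<close>.
  The recursion inverts \<open>y' = (w + 1) z\<close>: the derivative of a Gegenbauer polynomial \<open>y\<close> of degree
  \<open>w + 1\<close> is a multiple of the one, \<open>z\<close>, with \<open>m\<close> raised by 2, and then the differential equation
  gives \<open>y\<close> in terms of \<open>z\<close> and \<open>z'\<close>.
\<close>

fun geg :: "nat \<Rightarrow> real \<Rightarrow> complex poly" where
  "geg 0 m = 1"
| "geg (Suc w) m = Polynomial.smult (1 / complex_of_real (real w + m + 2))
     ([:0, complex_of_real (m + 2):] * geg w (m + 2) - [:1, 0, -1:] * pderiv (geg w (m + 2)))"

lemma poly_eqI_points: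
  fixes P Q :: "complex poly"
  assumes "\<And>x. poly P x = poly Q x"
  shows "P = Q"
  using assms poly_eq_poly_eq_iff by blast

text \<open>Both claims come from one induction: the equation for z simplifies the derivative of the
  recursion to y' = (w + 1) z, and substituting this back into the recursion is the equation for y.
  At \<open>w = 0\<close> the truncated \<open>w - 1\<close> is harmless, as its factor is
  zero.\<close>

lemma geg_ode_pderiv:
  assumes "m > -1"
  shows "[:1, 0, -1:] * pderiv (pderiv (geg w m)) - [:0, complex_of_real (m + 2):] * pderiv (geg w m)
           + Polynomial.smult (complex_of_real (real w * (real w + m + 1))) (geg w m) = 0 \<and>
         pderiv (geg w m) = Polynomial.smult (of_nat w) (geg (w - 1) (m + 2))"
  using assms
proof (induction w arbitrary: m)
  case 0
  then show ?case by simp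
next
  case (Suc w)
  define z where "z = geg w (m + 2)"
  define y where "y = geg (Suc w) m"
  define k where "k = complex_of_real (real w + m + 2)"
  have k0: "k \<noteq> 0" unfolding k_def of_real_eq_0_iff using Suc.prems by linarith
  define M where "M = complex_of_real m"
  have z: "[:1, 0, -1:] * pderiv (pderiv z) - [:0, M + 4:] * pderiv z
           + Polynomial.smult (of_nat w * (of_nat w + M + 3)) z = 0"
    using conjunct1[OF Suc.IH[of "m + 2"]] Suc.prems by (simp add: z_def M_def add_ac)
  have zx: "(1 - x\<^sup>2) * poly (pderiv (pderiv z)) x - (M + 4) * x * poly (pderiv z) x
           + (of_nat w * (of_nat w + M + 3)) * poly z x = 0" for x
    using arg_cong[OF z, of "\<lambda>P. poly P x"] by (simp add: algebra_simps power2_eq_square)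
  have y: "Polynomial.smult k y = [:0, M + 2:] * z - [:1, 0, -1:] * pderiv z"
    using k0 unfolding y_def geg.simps k_def[symmetric] z_def[symmetric] by (simp add: M_def)
  have "Polynomial.smult k (pderiv y) = pderiv (Polynomial.smult k y)" by (simp add: pderiv_smult)
  also have "\<dots> = Polynomial.smult k (Polynomial.smult (of_nat (Suc w)) z)"
  proof (rule poly_eqI_points)
    fix x
    have k: "k = of_nat w + M + 2" by (simp add: k_def M_def)
    show "poly (pderiv (Polynomial.smult k y)) x = poly (Polynomial.smult k (Polynomial.smult (of_nat (Suc w)) z)) x"
      using zx[of x] unfolding y
      by (simp add: k pderiv_diff pderiv_add pderiv_minus pderiv_smult pderiv_mult pderiv_pCons algebra_simps power2_eq_square)
  qed
  finally have dy: "pderiv y = Polynomial.smult (of_nat (Suc w)) z" using k0 smult_cancel by metis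
  have "Polynomial.smult (complex_of_real (real (Suc w) * (real (Suc w) + m + 1))) y = Polynomial.smult (of_nat (Suc w)) (Polynomial.smult k y)"
    by (simp add: k_def algebra_simps)
  then have "[:1, 0, -1:] * pderiv (pderiv y) - [:0, complex_of_real (m + 2):] * pderiv y
           + Polynomial.smult (complex_of_real (real (Suc w) * (real (Suc w) + m + 1))) y = 0"
    unfolding dy y by (simp add: pderiv_smult M_def smult_diff_right smult_add_right)
  then show ?case using dy by (simp only: y_def z_def diff_Suc_1)
qed

lemma poly_geg_ode:
  assumes "m > -1"
  shows "(1 - x\<^sup>2) * poly (pderiv (pderiv (geg w m))) x =
    (of_real m + 2) * x * poly (pderiv (geg w m)) x
      - of_nat w * (of_nat w + of_real m + 1) * poly (geg w m) x"
proof -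
  have "poly ([:1, 0, -1:] * pderiv (pderiv (geg w m)) - [:0, complex_of_real (m + 2):] * pderiv (geg w m)
           + Polynomial.smult (complex_of_real (real w * (real w + m + 1))) (geg w m)) x = 0"
    using conjunct1[OF geg_ode_pderiv[OF assms, of w]] by simp
  then show ?thesis by (simp add: algebra_simps power2_eq_square)
qed

lemma coeff_pCons_0_mult: "coeff ([:0, c:] * P) k = (if k = 0 then 0 else c * coeff P (k - 1))"
  by (cases k) (auto simp: mult_pCons_left)

lemma coeff_geg_Suc:
  "coeff (geg (Suc w) m) k = (1 / complex_of_real (real w + m + 2)) *
     ((if k = 0 then 0 else of_real (m + 2) * coeff (geg w (m + 2)) (k - 1))
      - of_nat (Suc k) * coeff (geg w (m + 2)) (Suc k)
      + (if k = 0 then 0 else of_nat (k - 1) * coeff (geg w (m + 2)) (k - 1)))"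
proof -
  have e: "[:1, 0, -1:] = 1 - monom (1::complex) 2"
    by (simp add: numeral_2_eq_2 monom_Suc monom_0 one_pCons)
  have "coeff (monom 1 2 * pderiv P) k = (if k = 0 then 0 else of_nat (k - 1) * coeff P (k - 1))"
    for P :: "complex poly"
    by (cases k; cases "k - 1") (auto simp: coeff_monom_mult coeff_pderiv)
  then show ?thesis
    by (simp only: geg.simps e left_diff_distrib coeff_smult coeff_diff coeff_pCons_0_mult coeff_pderiv mult_1_left)
       (simp add: algebra_simps)
qed

text \<open>The vanishing coefficient below the top is the only trace of parity that the later
  comparison of coefficients uses.\<close>

lemma coeff_geg:
  assumes "m > -1"
  shows coeff_geg_top: "coeff (geg w m) w = 1"
    and coeff_geg_above: "k > w \<Longrightarrow> coeff (geg w m) k = 0"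
    and coeff_geg_subtop: "w \<ge> 1 \<Longrightarrow> coeff (geg w m) (w - 1) = 0"
proof -
  have "coeff (geg w m) w = 1 \<and> (\<forall>k>w. coeff (geg w m) k = 0) \<and> (w \<ge> 1 \<longrightarrow> coeff (geg w m) (w - 1) = 0)"
    using assms
  proof (induction w arbitrary: m)
    case 0
    then show ?case by (simp add: coeff_eq_0)
  next
    case (Suc w)
    define k where "k = complex_of_real (real w + m + 2)"
    have k0: "k \<noteq> 0" unfolding k_def of_real_eq_0_iff using Suc.prems by linarith
    have IH: "coeff (geg w (m + 2)) w = 1" "\<forall>k>w. coeff (geg w (m + 2)) k = 0"
       "w \<ge> 1 \<longrightarrow> coeff (geg w (m + 2)) (w - 1) = 0"
      using Suc by simp_all
    have "coeff (geg (Suc w) m) (Suc w) = (1 / k) * k"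
      unfolding coeff_geg_Suc k_def[symmetric] using IH by (simp add: k_def)
    moreover have "coeff (geg (Suc w) m) j = 0" if "j > Suc w" for j
      unfolding coeff_geg_Suc using IH that by simp
    moreover have "coeff (geg (Suc w) m) w = 0"
      unfolding coeff_geg_Suc using IH by (cases "w = 0") auto
    ultimately show ?case using k0 by simp
  qed
  then show "coeff (geg w m) w = 1" "k > w \<Longrightarrow> coeff (geg w m) k = 0"
    "w \<ge> 1 \<Longrightarrow> coeff (geg w m) (w - 1) = 0" by auto
qed

text \<open>Real coefficients allow the conjugation in \<open>conj_transpose\<close> to be dropped
  at real points.\<close>

lemma coeff_geg_real: "coeff (geg w m) k \<in> \<real>"
proof (induction w arbitrary: m k)
  case 0
  then show ?case by (cases k) (simp_all add: one_pCons)
next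
  case (Suc w)
  show ?case unfolding coeff_geg_Suc
    by (auto intro!: Reals_mult Reals_add Reals_diff Suc Reals_divide simp del: of_nat_Suc)
qed

text \<open>At \<open>e\<close> = 1 or -1 the derivative term of the recursion drops out, so the
  value is a product of factors e (m + 2) / (w + m + 2) with \<open>m\<close> growing by 2.\<close>

lemma poly_geg_endpoint:
  assumes "m > -1" "e\<^sup>2 = 1"
  shows "poly (geg w m) e \<noteq> 0"
  using assms(1)
proof (induction w arbitrary: m)
  case (Suc w)
  have ee: "e * (e * a) = a" for a
    using assms(2) by (simp add: power2_eq_square mult.assoc[symmetric])
  have "poly (geg (Suc w) m) e =
      (1 / complex_of_real (real w + m + 2)) * (e * complex_of_real (m + 2) * poly (geg w (m + 2)) e)"
    by (simp add: algebra_simps ee)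
  moreover have "complex_of_real (real w + m + 2) \<noteq> 0" "complex_of_real (m + 2) \<noteq> 0"
    unfolding of_real_eq_0_iff using Suc.prems by linarith+
  moreover have "e \<noteq> 0" using assms(2) by auto
  ultimately show ?case using Suc.IH[of "m + 2"] Suc.prems by (simp del: geg.simps)
qed simp

text \<open>Differentiating the Gegenbauer equation \<open>i\<close> times changes m + 2 into m + 2
  + 2i and lowers the eigenvalue by i (i + m + 1). At an endpoint the coefficient of the highest
  derivative vanishes, so each derivative is a multiple of the preceding one.\<close>

lemma geg_endpoint_deriv:
  assumes "m > -1" "e\<^sup>2 = 1"
  shows "(of_real m + 2 + 2 * of_nat i) * poly ((pderiv ^^ Suc i) (geg w m)) e =
     e * (of_nat w * (of_nat w + of_real m + 1) - of_nat i * (of_nat i + of_real m + 1))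
       * poly ((pderiv ^^ i) (geg w m)) e"
proof -
  define M where "M = complex_of_real m"
  define l where "l = (\<lambda>i. of_nat w * (of_nat w + M + 1) - of_nat i * (of_nat i + M + 1))"
  have "[:1, 0, -1:] * (pderiv ^^ Suc (Suc i)) (geg w m) -
      [:0, M + 2 + 2 * of_nat i:] * (pderiv ^^ Suc i) (geg w m) + Polynomial.smult (l i) ((pderiv ^^ i) (geg w m)) = 0"
  proof (induction i)
    case 0
    show ?case using conjunct1[OF geg_ode_pderiv[OF assms(1), of w]] by (simp add: l_def M_def)
  next
    case (Suc i)
    define u where "u = (pderiv ^^ i) (geg w m)"
    have "pderiv ([:1, 0, -1:] * pderiv (pderiv u) -
      [:0, M + 2 + 2 * of_nat i:] * pderiv u + Polynomial.smult (l i) u) = 0"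
      using arg_cong[OF Suc, of pderiv] by (simp add: u_def)
    moreover have "l (Suc i) = l i - (M + 2 + 2 * of_nat i)" by (simp add: l_def algebra_simps)
    moreover have "pderiv ([:1, 0, -1:] * pderiv (pderiv u) -
      [:0, M + 2 + 2 * of_nat i:] * pderiv u + Polynomial.smult (l i) u) =
      [:1, 0, -1:] * pderiv (pderiv (pderiv u)) -
      [:0, M + 2 + 2 * of_nat (Suc i):] * pderiv (pderiv u) +
      Polynomial.smult (l i - (M + 2 + 2 * of_nat i)) (pderiv u)"
      by (rule poly_eqI_points)
        (simp add: pderiv_diff pderiv_add pderiv_minus pderiv_mult pderiv_pCons pderiv_smult algebra_simps)
    ultimately have "[:1, 0, -1:] * pderiv (pderiv (pderiv u)) -
      [:0, M + 2 + 2 * of_nat (Suc i):] * pderiv (pderiv u) + Polynomial.smult (l (Suc i)) (pderiv u) = 0"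
      by simp
    then show ?case by (simp add: u_def)
  qed
  note ode = this
  have "e * (M + 2 + 2 * of_nat i) * poly ((pderiv ^^ Suc i) (geg w m)) e = l i * poly ((pderiv ^^ i) (geg w m)) e"
  proof -
    have "e * (e * a) = a" for a
      using assms(2) by (simp add: power2_eq_square mult.assoc[symmetric])
    with arg_cong[OF ode, of "\<lambda>P. poly P e"] show ?thesis
      by (simp add: algebra_simps)
  qed
  then have "e * e * (M + 2 + 2 * of_nat i) * poly ((pderiv ^^ Suc i) (geg w m)) e = e * l i * poly ((pderiv ^^ i) (geg w m)) e"
    by (simp add: mult.assoc)
  moreover have "e * e = 1" using assms(2) by (simp add: power2_eq_square)
  ultimately show ?thesis by (simp add: l_def M_def)
qed

section \<open>Matrix differential operators\<close>

definition eval_at :: "complex \<Rightarrow> cmat_poly \<Rightarrow> cmat" where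
  "eval_at c M = map_matrix (\<lambda>q. poly q c) M"

lemma eval_at_nth [simp]: "eval_at c M $ i $ j = poly (M $ i $ j) c"
  by (simp add: eval_at_def)

lemma const_mpoly_nth [simp]: "const_mpoly A $ i $ j = [:A $ i $ j:]"
  by (simp add: const_mpoly_def)

lemma coeff_mpoly_nth [simp]: "coeff_mpoly P k $ i $ j = coeff (P $ i $ j) k"
  by (simp add: coeff_mpoly_def)

lemma deriv_mpoly_nth [simp]: "deriv_mpoly m P $ i $ j = (pderiv ^^ m) (P $ i $ j)"
  by (simp add: deriv_mpoly_def)

lemma matrix_mult_nth_2:
  fixes A B :: "'a::semiring_1^2^2"
  shows "(A ** B) $ i $ j = A $ i $ 1 * B $ 1 $ j + A $ i $ 2 * B $ 2 $ j"
  by (simp add: matrix_matrix_mult_def sum_2)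

lemma matrix_eqI_2:
  fixes A B :: "'a^2^2"
  assumes "A $ 1 $ 1 = B $ 1 $ 1" "A $ 1 $ 2 = B $ 1 $ 2" "A $ 2 $ 1 = B $ 2 $ 1" "A $ 2 $ 2 = B $ 2 $ 2"
  shows "A = B"
  using assms by (simp add: vec_eq_iff forall_2)

lemma matrix_add_rdistrib_2: "(A + B :: 'a::semiring_1^2^2) ** C = A ** C + B ** (C :: 'a^2^2)"
  by (rule matrix_eqI_2) (simp_all add: matrix_mult_nth_2 distrib_right ac_simps)

lemma mpoly_eqI: "(\<And>k. coeff_mpoly P k = coeff_mpoly Q k) \<Longrightarrow> P = Q"
  by (simp add: vec_eq_iff poly_eq_iff)

lemma mat_nth: "mat c $ i $ j = (if i = j then c else 0)"
  by (simp add: mat_def)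

lemma mat_commute:
  fixes A :: "'a::comm_semiring_1^2^2"
  shows "mat c ** A = A ** mat c"
  by (rule matrix_eqI_2) (simp_all add: matrix_mult_nth_2 mat_nth mult.commute)

lemma const_mpoly_mult: "const_mpoly (A ** B) = const_mpoly A ** const_mpoly B"
  by (simp add: vec_eq_iff matrix_mult_nth_2 mult.commute)

lemma const_mpoly_add: "const_mpoly (A + B) = const_mpoly A + const_mpoly B"
  by (simp add: vec_eq_iff)

lemma const_mpoly_mat: "const_mpoly (mat c) = mat [:c:]"
  by (simp add: vec_eq_iff mat_nth)

lemma const_mpoly_0 [simp]: "const_mpoly 0 = 0"
  by (simp add: vec_eq_iff)

lemma const_mpoly_1 [simp]: "const_mpoly (mat 1) = mat 1"
  by (simp add: vec_eq_iff mat_nth one_pCons)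

lemma smult_mpoly_eq: "smult_mpoly c P = const_mpoly (mat c) ** P"
  by (rule matrix_eqI_2) (simp_all add: smult_mpoly_def matrix_mult_nth_2 mat_nth)

lemma coeff_mpoly_const_mult: "coeff_mpoly (const_mpoly A ** P) k = A ** coeff_mpoly P k"
  by (simp add: vec_eq_iff matrix_mult_nth_2)

lemma coeff_mpoly_add: "coeff_mpoly (P + Q) k = coeff_mpoly P k + coeff_mpoly Q k"
  by (simp add: vec_eq_iff)

lemma coeff_mpoly_diff: "coeff_mpoly (P - Q) k = coeff_mpoly P k - coeff_mpoly Q k"
  by (simp add: vec_eq_iff)

section \<open>Expansion in monic sequences and left-linear maps\<close>

lemma mpoly_degree_bound:
  obtains d where "\<And>k. k \<ge> d \<Longrightarrow> coeff_mpoly P k = 0"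
proof
  fix k
  assume "k \<ge> Suc (\<Sum>i\<in>UNIV. \<Sum>j\<in>UNIV. degree (P $ i $ j))"
  then have "degree (P $ i $ j) < k" for i j
    using exhaust_2[of i] exhaust_2[of j] by (auto simp: sum_2)
  then show "coeff_mpoly P k = 0" by (simp add: vec_eq_iff coeff_eq_0)
qed

text \<open>Leading coefficients are split off one degree at a time; thus \<open>Q\<close> generates
  M_2[x] as a left module over the constant matrices.\<close>

lemma monic_span:
  assumes "\<And>k. monic_mpoly k (Q k)" "\<And>k. k \<ge> d \<Longrightarrow> coeff_mpoly P k = 0"
  shows "\<exists>A. P = (\<Sum>k<d. const_mpoly (A k) ** Q k)"
  using assms(2)
proof (induction d arbitrary: P)
  case 0
  then have "P = 0" by (intro mpoly_eqI) (simp add: vec_eq_iff)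
  then show ?case by simp
next
  case (Suc d)
  define R where "R = P - const_mpoly (coeff_mpoly P d) ** Q d"
  have "coeff_mpoly R k = 0" if "k \<ge> d" for k
    using that Suc.prems[of k] assms(1)[of d]
    by (cases "k = d") (auto simp: R_def coeff_mpoly_diff coeff_mpoly_const_mult monic_mpoly_def)
  from Suc.IH[OF this] obtain A where A: "R = (\<Sum>k<d. const_mpoly (A k) ** Q k)" by blast
  have "P = (\<Sum>k<Suc d. const_mpoly ((A(d := coeff_mpoly P d)) k) ** Q k)"
    using A by (simp add: R_def algebra_simps)
  then show ?case by blast
qed

text \<open>Differential operators act on the right and hence commute with constant matrices on the
  left. This property alone makes an operator determined by its values on a monic sequence.\<close>

definition left_linear :: "mop \<Rightarrow> bool" where
  "left_linear D \<longleftrightarrow> (\<forall>P Q. D (P + Q) = D P + D Q) \<and>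
     (\<forall>A P. D (const_mpoly A ** P) = const_mpoly A ** D P)"

lemma left_linear_add: "left_linear D \<Longrightarrow> D (P + Q) = D P + D Q"
  and left_linear_const: "left_linear D \<Longrightarrow> D (const_mpoly A ** P) = const_mpoly A ** D P"
  by (simp_all add: left_linear_def)

lemma left_linear_0: "left_linear D \<Longrightarrow> D 0 = 0"
  using left_linear_const[of D 0 0] by (simp add: vec_eq_iff matrix_mult_nth_2)

lemma left_linear_sum: "left_linear D \<Longrightarrow> D (\<Sum>k\<in>S. f k) = (\<Sum>k\<in>S. D (f k))"
  by (induction S rule: infinite_finite_induct) (simp_all add: left_linear_0 left_linear_add)

lemma higher_pderiv_add: "(pderiv ^^ m) (p + q :: complex poly) = (pderiv ^^ m) p + (pderiv ^^ m) q"
  by (induction m) (simp_all add: pderiv_add)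

lemma higher_pderiv_smult: "(pderiv ^^ m) (Polynomial.smult c p) = Polynomial.smult c ((pderiv ^^ m) (p :: complex poly))"
  by (induction m) (simp_all add: pderiv_smult)

lemma diff_op_left_linear: "left_linear (diff_op s F)"
proof -
  have "deriv_mpoly m (const_mpoly A ** P) = const_mpoly A ** deriv_mpoly m P" for m A P
    by (simp add: vec_eq_iff matrix_mult_nth_2 higher_pderiv_add higher_pderiv_smult)
  moreover have "deriv_mpoly m (P + Q) = deriv_mpoly m P + deriv_mpoly m Q" for m P Q
    by (simp add: vec_eq_iff higher_pderiv_add)
  moreover have "(\<Sum>i\<in>S. const_mpoly A ** f i) = const_mpoly A ** (\<Sum>i\<in>S. f i)" for S :: "nat set" and A and f :: "nat \<Rightarrow> cmat_poly"
    by (induction S rule: infinite_finite_induct)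
       (simp_all add: matrix_add_ldistrib vec_eq_iff matrix_mult_nth_2)
  then have "(\<Sum>i\<in>S. const_mpoly A ** f i ** g i) = const_mpoly A ** (\<Sum>i\<in>S. f i ** g i)" for S :: "nat set" and A and f g :: "nat \<Rightarrow> cmat_poly"
    by (simp only: matrix_mul_assoc[symmetric])
  ultimately show ?thesis
    unfolding left_linear_def diff_op_def matrix_mul_assoc[symmetric]
    by (simp add: matrix_add_rdistrib_2 sum.distrib matrix_mul_assoc[symmetric] del: matrix_mul_assoc)
qed

lemma diff_ops_left_linear: "D \<in> diff_ops \<Longrightarrow> left_linear D"
  using diff_op_left_linear by (auto simp: diff_ops_def)

lemma left_linear_ext:
  assumes D: "left_linear D" "left_linear E"
    and Q: "\<And>k. monic_mpoly k (Q k)" and eq: "\<And>k. D (Q k) = E (Q k)"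
  shows "D = E"
proof
  fix P
  obtain d where "\<And>k. k \<ge> d \<Longrightarrow> coeff_mpoly P k = 0" using mpoly_degree_bound by blast
  from monic_span[OF Q this] obtain A where "P = (\<Sum>k<d. const_mpoly (A k) ** Q k)" by blast
  then show "D P = E P" by (simp add: left_linear_sum left_linear_const D eq)
qed

text \<open>Monic eigenvectors in every degree force the operator to preserve degree bounds; this
  stands in for the bound deg F_i <= i on the coefficients.\<close>

lemma left_linear_degree:
  assumes D: "left_linear D"
    and Q: "\<And>k. monic_mpoly k (Q k)" "\<And>k. D (Q k) = const_mpoly (L k) ** Q k"
    and P: "\<And>k. k \<ge> d \<Longrightarrow> coeff_mpoly P k = 0" and k: "k \<ge> d"
  shows "coeff_mpoly (D P) k = 0"
proof -
  from monic_span[OF Q(1) P] obtain A where "P = (\<Sum>k<d. const_mpoly (A k) ** Q k)" by blast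
  then have "D P = (\<Sum>k<d. const_mpoly (A k) ** (const_mpoly (L k) ** Q k))"
    by (simp add: left_linear_sum left_linear_const D Q(2))
  moreover have "coeff_mpoly (\<Sum>j\<in>S. f j) k = (\<Sum>j\<in>S. coeff_mpoly (f j) k)" for S :: "nat set" and f
    by (induction S rule: infinite_finite_induct) (simp_all add: coeff_mpoly_add vec_eq_iff)
  moreover have "coeff_mpoly (const_mpoly (A j) ** (const_mpoly (L j) ** Q j)) k = 0" if "j < d" for j
  proof -
    have "coeff_mpoly (Q j) k = 0" using Q(1)[of j] that k by (simp add: monic_mpoly_def)
    then show ?thesis by (simp add: coeff_mpoly_const_mult vec_eq_iff matrix_mult_nth_2)
  qed
  ultimately show ?thesis by simp
qed

section \<open>Closure properties of differential operators\<close>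

lemma diff_op_pad:
  assumes "s \<le> t"
  shows "diff_op s F = diff_op t (\<lambda>i. if i \<le> s then F i else 0)"
proof
  fix P
  have "(\<Sum>i\<le>t. deriv_mpoly i P ** (if i \<le> s then F i else 0)) = (\<Sum>i\<le>s. deriv_mpoly i P ** F i)"
    using assms by (intro sum.mono_neutral_cong_right) (auto simp: vec_eq_iff matrix_mult_nth_2)
  then show "diff_op s F P = diff_op t (\<lambda>i. if i \<le> s then F i else 0) P"
    by (simp add: diff_op_def)
qed

lemma diff_ops_id: "(\<lambda>P. P) \<in> diff_ops"
proof -
  have "(\<lambda>P. P) = diff_op 0 (\<lambda>_. mat 1)" by (auto simp: diff_op_def deriv_mpoly_def vec_eq_iff)
  then show ?thesis by (auto simp: diff_ops_def)
qed

lemma diff_ops_add: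
  assumes "D \<in> diff_ops" "E \<in> diff_ops"
  shows "(\<lambda>P. D P + E P) \<in> diff_ops"
proof -
  obtain s F t G where D: "D = diff_op s F" "E = diff_op t G" using assms by (auto simp: diff_ops_def)
  define F' G' where "F' = (\<lambda>i. if i \<le> s then F i else 0)" "G' = (\<lambda>i. if i \<le> t then G i else 0)"
  have "D = diff_op (max s t) F'" "E = diff_op (max s t) G'"
    unfolding D F'_G'_def by (rule diff_op_pad; simp)+
  then have "(\<lambda>P. D P + E P) = diff_op (max s t) (\<lambda>i. F' i + G' i)"
    by (auto simp: diff_op_def matrix_add_ldistrib sum.distrib)
  then show ?thesis by (auto simp: diff_ops_def)
qed

lemma sum_matrix_mult_right:
  fixes f :: "'b \<Rightarrow> cmat_poly" and B :: cmat_poly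
  shows "(\<Sum>i\<in>S. f i ** B) = (\<Sum>i\<in>S. f i) ** B"
  by (induction S rule: infinite_finite_induct)
     (simp_all add: matrix_add_rdistrib_2 vec_eq_iff matrix_mult_nth_2)

lemma diff_ops_mult_right:
  assumes "D \<in> diff_ops"
  shows "(\<lambda>P. D P ** B) \<in> diff_ops"
proof -
  obtain s F where D: "D = diff_op s F" using assms by (auto simp: diff_ops_def)
  have "(\<lambda>P. D P ** B) = diff_op s (\<lambda>i. F i ** B)"
    by (auto simp: D diff_op_def sum_matrix_mult_right[symmetric] matrix_mul_assoc)
  then show ?thesis by (auto simp: diff_ops_def)
qed

lemma deriv_mpoly_sum: "deriv_mpoly m (\<Sum>i\<in>S. f i) = (\<Sum>i\<in>S. deriv_mpoly m (f i))"
proof -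
  have "deriv_mpoly m 0 = 0" by (induction m) (simp_all add: vec_eq_iff)
  then show ?thesis
    by (induction S rule: infinite_finite_induct) (simp_all add: vec_eq_iff higher_pderiv_add)
qed

text \<open>The Leibniz rule splits the result into an operator of order one higher and one with
  differentiated coefficients. Iteration then yields composition.\<close>

lemma diff_ops_deriv:
  assumes "D \<in> diff_ops"
  shows "(\<lambda>P. deriv_mpoly 1 (D P)) \<in> diff_ops"
proof -
  obtain s F where D: "D = diff_op s F" using assms by (auto simp: diff_ops_def)
  have 1: "(\<lambda>P. \<Sum>i\<le>s. deriv_mpoly (Suc i) P ** F i) = diff_op (Suc s) (\<lambda>i. if i = 0 then 0 else F (i - 1))"
    proof
    fix P
    have "diff_op (Suc s) (\<lambda>i. if i = 0 then 0 else F (i - 1)) P =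
      deriv_mpoly 0 P ** 0 + (\<Sum>i\<le>s. deriv_mpoly (Suc i) P ** F i)"
      unfolding diff_op_def by (subst sum.atMost_Suc_shift) simp
    also have "deriv_mpoly 0 P ** (0 :: cmat_poly) = 0" by (simp add: vec_eq_iff matrix_mult_nth_2)
    finally show "(\<Sum>i\<le>s. deriv_mpoly (Suc i) P ** F i) = diff_op (Suc s) (\<lambda>i. if i = 0 then 0 else F (i - 1)) P"
      by simp
  qed
  have "deriv_mpoly 1 (A ** B) = deriv_mpoly 1 A ** B + A ** deriv_mpoly 1 B" for A B
    by (simp add: vec_eq_iff matrix_mult_nth_2 pderiv_add pderiv_mult algebra_simps)
  moreover have "deriv_mpoly 1 (deriv_mpoly i P) = deriv_mpoly (Suc i) P" for i P
    by (simp add: vec_eq_iff)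
  ultimately have "(\<lambda>P. deriv_mpoly 1 (D P)) =
      (\<lambda>P. (\<Sum>i\<le>s. deriv_mpoly (Suc i) P ** F i) + diff_op s (\<lambda>i. deriv_mpoly 1 (F i)) P)"
    by (auto simp: D diff_op_def deriv_mpoly_sum sum.distrib)
  also have "\<dots> \<in> diff_ops"
    by (rule diff_ops_add) (use 1 in \<open>unfold diff_ops_def, blast+\<close>)
  finally show ?thesis .
qed

lemma diff_ops_0: "(\<lambda>P. 0) \<in> diff_ops"
proof -
  have "(\<lambda>P. 0) = (\<lambda>P. P ** (0 :: cmat_poly))" by (auto simp: vec_eq_iff matrix_mult_nth_2)
  then show ?thesis using diff_ops_mult_right[OF diff_ops_id, of 0] by simp
qed

lemma diff_ops_sum: "(\<And>i. i \<in> S \<Longrightarrow> f i \<in> diff_ops) \<Longrightarrow> (\<lambda>P. \<Sum>i\<in>S. f i P) \<in> diff_ops"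
  by (induction S rule: infinite_finite_induct) (simp_all add: diff_ops_0 diff_ops_add)

lemma diff_ops_comp:
  assumes "D \<in> diff_ops" "E \<in> diff_ops"
  shows "(\<lambda>P. E (D P)) \<in> diff_ops"
proof -
  obtain s F where E: "E = diff_op s F" using assms by (auto simp: diff_ops_def)
  have "(\<lambda>P. deriv_mpoly i (D P)) \<in> diff_ops" for i
  proof (induction i)
    case 0
    have "deriv_mpoly 0 P = P" for P by (simp add: vec_eq_iff)
    then show ?case using assms(1) by simp
  next
    case (Suc i)
    have "(\<lambda>P. deriv_mpoly (Suc i) (D P)) = (\<lambda>P. deriv_mpoly 1 (deriv_mpoly i (D P)))"
      by (auto simp: vec_eq_iff)
    then show ?case using diff_ops_deriv[OF Suc] by simp
  qed
  then show ?thesis unfolding E diff_op_def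
    by (intro diff_ops_sum diff_ops_mult_right) auto
qed

text \<open>Scalar matrices are central, so this left multiplication can be rewritten as a right
  multiplication, which differential operators allow.\<close>

lemma diff_ops_const_left:
  assumes "D \<in> diff_ops"
  shows "(\<lambda>P. const_mpoly (mat c) ** D P) \<in> diff_ops"
  using diff_ops_mult_right[OF assms, of "mat [:c:]"] by (simp add: const_mpoly_mat mat_commute)

text \<open>The factor is the falling factorial k (k - 1) ... (k - i + 1) as a polynomial in
  \<open>k\<close>. It vanishes for \<open>i > k\<close>, so the truncated exponent
  \<open>k - i\<close> is then irrelevant.\<close>

lemma higher_pderiv_monom_falling:
  "(pderiv ^^ i) (monom (1::complex) k) = monom (poly (\<Prod>j<i. [:- of_nat j, 1:]) (of_nat k)) (k - i)"
proof (induction i)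
  case (Suc i)
  have 1: "poly (\<Prod>j<i. [:- of_nat j, 1:]) (of_nat k) * of_nat (k - i) =
      poly (\<Prod>j<Suc i. [:- of_nat j, 1:]) (of_nat k :: complex)"
  proof (cases "i \<le> k")
    case True
    then show ?thesis by (simp add: of_nat_diff algebra_simps)
  next
    case False
    then have "poly (\<Prod>j<i. [:- of_nat j, 1:]) (of_nat k :: complex) = 0"
      unfolding poly_prod by (intro prod_zero) auto
    then show ?thesis by simp
  qed
  have "(pderiv ^^ Suc i) (monom (1::complex) k) =
      pderiv (monom (poly (\<Prod>j<i. [:- of_nat j, 1:]) (of_nat k)) (k - i))"
    by (simp add: Suc)
  also have "\<dots> = monom (poly (\<Prod>j<i. [:- of_nat j, 1:]) (of_nat k) * of_nat (k - i)) (k - Suc i)"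
    by (simp add: pderiv_monom mult.commute)
  finally show ?case unfolding 1 .
qed simp

text \<open>Only the coefficient of x^i, respectively x^(i-1), in \<open>F i\<close> contributes,
  weighted by a falling factorial in \<open>k\<close>. Polynomial dependence on \<open>k\<close>
  later justifies evaluation outside the naturals.\<close>

lemma diff_op_monom_coeff:
  assumes "D \<in> diff_ops"
  shows "\<exists>A. \<forall>k. coeff_mpoly (D (mat (monom 1 k))) k = eval_at (of_nat k) A"
    and "\<exists>B. \<forall>k\<ge>1. coeff_mpoly (D (mat (monom 1 k))) (k - 1) = eval_at (of_nat k) B"
proof -
  obtain s F where D: "D = diff_op s F" using assms by (auto simp: diff_ops_def)
  define ff where "ff = (\<lambda>i. \<Prod>j<i. [:- of_nat j, 1 :: complex:])"
  have ff0: "poly (ff i) (of_nat k) = 0" if "k < i" for i k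
    unfolding ff_def poly_prod using that by (intro prod_zero) auto
  have "coeff_mpoly (D (mat (monom 1 k))) m $ a $ b =
      (\<Sum>i\<le>s. coeff (monom (poly (ff i) (of_nat k)) (k - i) * F i $ a $ b) m)" for k m a b
  proof -
    have "(deriv_mpoly i (mat (monom 1 k)) ** F i) $ a $ b = monom (poly (ff i) (of_nat k)) (k - i) * F i $ a $ b" for i
      using exhaust_2[of a] higher_pderiv_monom_falling[of i k] funpow_simps_right
      by (auto simp: matrix_mult_nth_2 mat_nth ff_def)
    then show ?thesis by (simp add: D diff_op_def coeff_sum)
  qed
  note 1 = this
  have 2: "coeff (monom (poly (ff i) (of_nat k)) (k - i) * f) k = poly (ff i) (of_nat k) * coeff f i" for i k f
    using ff0[of k i] by (cases "i \<le> k") (auto simp: coeff_monom_mult)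
  have 3: "coeff (monom (poly (ff i) (of_nat k)) (k - i) * f) (k - 1) =
     poly (ff i) (of_nat k) * (if i = 0 then 0 else coeff f (i - 1))" if "k \<ge> 1" for i k f
    using ff0[of k i] that by (cases "i \<le> k") (auto simp: coeff_monom_mult)
  show "\<exists>A. \<forall>k. coeff_mpoly (D (mat (monom 1 k))) k = eval_at (of_nat k) A"
    by (rule exI[of _ "\<chi> a b. \<Sum>i\<le>s. Polynomial.smult (coeff (F i $ a $ b) i) (ff i)"])
       (auto simp: vec_eq_iff poly_sum 1[unfolded coeff_mpoly_nth] 2 intro!: sum.cong)
  show "\<exists>B. \<forall>k\<ge>1. coeff_mpoly (D (mat (monom 1 k))) (k - 1) = eval_at (of_nat k) B"
    by (rule exI[of _ "\<chi> a b. \<Sum>i\<le>s. Polynomial.smult (if i = 0 then 0 else coeff (F i $ a $ b) (i - 1)) (ff i)"])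
       (auto simp: vec_eq_iff poly_sum 1[unfolded coeff_mpoly_nth] 3[simplified] intro!: sum.cong)
qed

section \<open>Integration against the Gegenbauer weight\<close>

text \<open>The exponent is that of the matrix weight. The Gegenbauer weight of
  \<open>geg w n\<close> has exponent n/2, so its missing factor 1 - x^2 appears in the integrands
  as \<open>[:1, 0, -1:]\<close>.\<close>

definition gegint :: "real \<Rightarrow> complex poly \<Rightarrow> complex" where
  "gegint n f = (LBINT x:{-1..1}. complex_of_real ((1 - x\<^sup>2) powr (n / 2 - 1)) * poly f (complex_of_real x))"

text \<open>The substitution t = (1 + x) / 2 turns the Beta integrand t^a (1 - t)^a into (1/4)^a (1
  - x^2)^a, with a = n/2 - 1.\<close>

lemma set_integrable_geg_weight:
  assumes "n > 0"
  shows "set_integrable lborel {-1..1} (\<lambda>x::real. (1 - x\<^sup>2) powr (n / 2 - 1))"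
proof -
  define a where "a = n / 2 - 1"
  have "integrable lborel (\<lambda>t. indicat_real {0..1} t *\<^sub>R (t powr a * (1 - t) powr a))"
    using integrable_Beta[of "n / 2" "n / 2"] assms by (simp add: set_integrable_def a_def)
  from lborel_integrable_real_affine[OF this, of "1/2" "1/2"]
  have "integrable lborel (\<lambda>x::real. indicat_real {0..1} (1/2 + 1/2 * x) *\<^sub>R
      ((1/2 + 1/2 * x) powr a * (1 - (1/2 + 1/2 * x)) powr a))" by simp
  also have "(\<lambda>x::real. indicat_real {0..1} (1/2 + 1/2 * x) *\<^sub>R
      ((1/2 + 1/2 * x) powr a * (1 - (1/2 + 1/2 * x)) powr a)) =
      (\<lambda>x. (1/4) powr a * (indicator {-1..1} x *\<^sub>R ((1 - x\<^sup>2) powr a)))"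
  proof
    fix x :: real
    have "(1/2 + 1/2 * x) powr a * (1 - (1/2 + 1/2 * x)) powr a = (1/4) powr a * (1 - x\<^sup>2) powr a"
      if "x \<in> {-1..1}"
    proof -
      have "(1/2 + 1/2 * x) powr a * (1 - (1/2 + 1/2 * x)) powr a =
         ((1/2 + 1/2 * x) * (1 - (1/2 + 1/2 * x))) powr a"
        by (rule powr_mult[symmetric])
      also have "(1/2 + 1/2 * x) * (1 - (1/2 + 1/2 * x)) = (1/4) * (1 - x\<^sup>2)"
        by (simp add: field_simps power2_eq_square)
      also have "\<dots> powr a = (1/4) powr a * (1 - x\<^sup>2) powr a"
        by (rule powr_mult)
      finally show ?thesis .
    qed
    moreover have "1/2 + 1/2 * x \<in> {0..1} \<longleftrightarrow> x \<in> {-1..1}" by auto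
    ultimately show "indicat_real {0..1} (1/2 + 1/2 * x) *\<^sub>R
      ((1/2 + 1/2 * x) powr a * (1 - (1/2 + 1/2 * x)) powr a) =
      (1/4) powr a * (indicator {-1..1} x *\<^sub>R ((1 - x\<^sup>2) powr a))"
      by (auto simp: indicator_def)
  qed
  finally have "integrable lborel (\<lambda>x::real. 4 powr a * ((1/4) powr a * (indicator {-1..1} x *\<^sub>R ((1 - x\<^sup>2) powr a))))"
    by (rule integrable_mult_right)
  moreover have "4 powr a * ((1/4) powr a * c) = c" for c
    by (simp add: mult.assoc[symmetric] powr_mult[symmetric])
  ultimately show ?thesis unfolding set_integrable_def a_def by simp
qed

lemma set_integrable_geg_weight_poly:
  assumes "n > 0"
  shows "set_integrable lborel {-1..1}
    (\<lambda>x. complex_of_real ((1 - x\<^sup>2) powr (n / 2 - 1)) * poly f (complex_of_real x))"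
proof -
  have "continuous_on {-1..1} (\<lambda>x. poly f (complex_of_real x))"
    by (intro continuous_intros)
  then have "bounded ((\<lambda>x. poly f (complex_of_real x)) ` {-1..1})"
    using compact_continuous_image compact_imp_bounded compact_Icc by blast
  then obtain B where "\<forall>y \<in> (\<lambda>x. poly f (complex_of_real x)) ` {-1..1}. norm y \<le> B"
    unfolding bounded_iff by blast
  then have B: "norm (poly f (complex_of_real x)) \<le> B" if "x \<in> {-1..1}" for x
    using that by blast
  show ?thesis
  proof (rule set_integrable_bound)
    show "set_integrable lborel {-1..1} (\<lambda>x::real. B * (1 - x\<^sup>2) powr (n / 2 - 1))"
      using set_integrable_geg_weight[OF assms] by simp
    have "(\<lambda>x. poly f (complex_of_real x)) \<in> borel_measurable borel"
      by (intro borel_measurable_continuous_onI continuous_intros)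
    then show "set_borel_measurable lborel {-1..1}
      (\<lambda>x. complex_of_real ((1 - x\<^sup>2) powr (n / 2 - 1)) * poly f (complex_of_real x))"
      unfolding set_borel_measurable_def by measurable
    show "AE x in lborel. x \<in> {-1..1} \<longrightarrow>
      norm (complex_of_real ((1 - x\<^sup>2) powr (n / 2 - 1)) * poly f (complex_of_real x))
        \<le> norm (B * (1 - x\<^sup>2) powr (n / 2 - 1))"
    proof (intro AE_I2 impI)
      fix x :: real assume "x \<in> {-1..1}"
      from B[OF this] show "norm (complex_of_real ((1 - x\<^sup>2) powr (n / 2 - 1)) * poly f (complex_of_real x))
        \<le> norm (B * (1 - x\<^sup>2) powr (n / 2 - 1))"
        by (simp add: norm_mult mult.commute abs_mult) (intro mult_right_mono, auto)
    qed
  qed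
qed

lemma gegint_add: "n > 0 \<Longrightarrow> gegint n (f + g) = gegint n f + gegint n g"
  unfolding gegint_def poly_add distrib_left
  by (intro set_integral_add(2) set_integrable_geg_weight_poly)

lemma gegint_smult: "gegint n (Polynomial.smult c f) = c * gegint n f"
  unfolding gegint_def poly_smult mult.left_commute[of _ c] by simp

text \<open>\<open>(1 - x\<^sup>2)\<^bsup>n/2 - 1\<^esup> geg_adj n f\<close> is the derivative of \<open>(1 - x\<^sup>2)\<^bsup>n/2\<^esup> f\<close>.\<close>

definition geg_adj :: "real \<Rightarrow> complex poly \<Rightarrow> complex poly" where
  "geg_adj n f = [:1, 0, -1:] * pderiv f - [:0, complex_of_real n:] * f"

text \<open>The fundamental theorem of calculus applies with a primitive that vanishes at both
  endpoints. Its interior version is used because the derivative may be unbounded at the endpoints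
  when \<open>n\<close> is small.\<close>

lemma gegint_geg_adj:
  assumes "n > 0"
  shows "gegint n (geg_adj n f) = 0"
proof -
  define G where "G = (\<lambda>x. complex_of_real ((1 - x\<^sup>2) powr (n / 2)) * poly f (complex_of_real x))"
  define g where "g = (\<lambda>x. complex_of_real ((1 - x\<^sup>2) powr (n / 2 - 1)) * poly (geg_adj n f) (complex_of_real x))"
  have "(g has_integral (G 1 - G (-1))) {-1..1}"
  proof (rule fundamental_theorem_of_calculus_interior)
    show "continuous_on {-1..1} G"
    proof -
      have "0 \<le> 1 - x\<^sup>2" if "x \<in> {-1..1}" for x :: real
        using that by (simp add: abs_square_le_1 abs_le_iff)
      then have "continuous_on {-1..1} (\<lambda>x::real. (1 - x\<^sup>2) powr (n / 2))"
        using assms by (intro continuous_on_powr' continuous_intros) auto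
      then show ?thesis unfolding G_def
        by (intro continuous_on_mult continuous_on_of_real continuous_on_poly continuous_on_id)
    qed
    fix x :: real assume x: "x \<in> {-1<..<1}"
    have x1: "1 - x\<^sup>2 > 0" using x by (simp add: abs_square_less_1 abs_less_iff)
    have "((\<lambda>x. (1 - x\<^sup>2) powr (n / 2)) has_field_derivative (n / 2) * (1 - x\<^sup>2) powr (n / 2 - 1) * (- 2 * x)) (at x)"
      using x1 by (auto intro!: derivative_eq_intros simp: powr_diff)
    then have "((\<lambda>x. complex_of_real ((1 - x\<^sup>2) powr (n / 2))) has_vector_derivative
       complex_of_real ((n / 2) * (1 - x\<^sup>2) powr (n / 2 - 1) * (- 2 * x))) (at x)"
      by (intro has_vector_derivative_of_real) (simp add: has_real_derivative_iff_has_vector_derivative)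
    moreover have "((\<lambda>x. poly f (complex_of_real x)) has_vector_derivative poly (pderiv f) (complex_of_real x)) (at x)"
      by (intro has_vector_derivative_real_field poly_DERIV)
    ultimately have "(G has_vector_derivative
       (complex_of_real ((1 - x\<^sup>2) powr (n / 2)) * poly (pderiv f) (complex_of_real x) +
        complex_of_real ((n / 2) * (1 - x\<^sup>2) powr (n / 2 - 1) * (- 2 * x)) * poly f (complex_of_real x))) (at x)"
      unfolding G_def by (rule has_vector_derivative_mult)
    also have "(complex_of_real ((1 - x\<^sup>2) powr (n / 2)) * poly (pderiv f) (complex_of_real x) +
        complex_of_real ((n / 2) * (1 - x\<^sup>2) powr (n / 2 - 1) * (- 2 * x)) * poly f (complex_of_real x)) = g x"
    proof -
      have "(1 - x\<^sup>2) powr (n / 2) = (1 - x\<^sup>2) powr (n / 2 - 1) * (1 - x\<^sup>2)"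
        using x1 by (simp add: powr_diff)
      then show ?thesis unfolding g_def geg_adj_def
        by (simp only:) (simp add: algebra_simps power2_eq_square)
    qed
    finally show "(G has_vector_derivative g x) (at x)" .
  qed simp
  moreover have "G 1 = 0" "G (-1) = 0" by (simp_all add: G_def)
  ultimately have "integral {-1..1} g = 0" by (simp add: integral_unique)
  moreover have "gegint n (geg_adj n f) = integral {-1..1} g"
    unfolding gegint_def g_def
    by (rule set_borel_integral_eq_integral(2)[OF set_integrable_geg_weight_poly[OF assms]])
  ultimately show ?thesis by simp
qed

lemma poly_real_coeffs_of_real:
  fixes f :: "complex poly"
  assumes "\<And>k. coeff f k \<in> \<real>"
  shows "cnj (poly f (complex_of_real x)) = poly f (complex_of_real x)"
proof -
  have "cnj (coeff f k) = coeff f k" for k using assms by (simp add: Reals_cnj_iff)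
  then show ?thesis by (simp add: poly_altdef)
qed

text \<open>At real points \<open>f\<close> is real, so the integrand is nonnegative on the interval
  and positive on its interior except at the finitely many roots of \<open>f\<close>. A zero
  integral would make (-1, 1) a null set.\<close>

lemma gegint_square_nonzero:
  assumes n: "n > 0" and f: "f \<noteq> 0" "\<And>k. coeff f k \<in> \<real>"
  shows "gegint n ([:1, 0, -1:] * (f * f)) \<noteq> 0"
proof
  assume zero: "gegint n ([:1, 0, -1:] * (f * f)) = 0"
  define r where "r = (\<lambda>x. Re (poly f (complex_of_real x)))"
  have fr: "poly f (complex_of_real x) = complex_of_real (r x)" for x
    using poly_real_coeffs_of_real[OF f(2), of x] by (simp add: r_def complex_eq_iff)
  define h where "h = (\<lambda>x. indicator {-1..1} x * ((1 - x\<^sup>2) powr (n / 2 - 1) * ((1 - x\<^sup>2) * (r x)\<^sup>2)))"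
  have hh: "indicat_real {-1..1} x *\<^sub>R (complex_of_real ((1 - x\<^sup>2) powr (n / 2 - 1)) *
      poly ([:1, 0, -1:] * (f * f)) (complex_of_real x)) = complex_of_real (h x)" for x
    by (simp add: h_def fr indicator_def power2_eq_square algebra_simps)
  have "integrable lborel (\<lambda>x. complex_of_real (h x))"
    using set_integrable_geg_weight_poly[OF n, of "[:1, 0, -1:] * (f * f)"]
    unfolding set_integrable_def hh .
  then have int: "integrable lborel h" by (simp only: complex_of_real_integrable_eq)
  have "complex_of_real (integral\<^sup>L lborel h) = 0"
    using zero unfolding gegint_def set_lebesgue_integral_def hh by simp
  then have "integral\<^sup>L lborel h = 0" by simp
  moreover have nonneg: "h x \<ge> 0" for x
  proof (cases "x \<in> {-1..1}")
    case True
    then have "0 \<le> 1 - x\<^sup>2" by (simp add: abs_square_le_1 abs_le_iff)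
    then show ?thesis unfolding h_def by simp
  qed (simp add: h_def)
  ultimately have ae: "AE x in lborel. h x = 0"
    using integral_nonneg_eq_0_iff_AE[OF int] by simp
  have "finite {z. poly f z = 0}" using f(1) by (rule poly_roots_finite)
  then have "finite {x. poly f (complex_of_real x) = 0}"
    using finite_vimageI[of "{z. poly f z = 0}" complex_of_real]
    by (simp add: inj_on_def vimage_def)
  then have "AE x in lborel. x \<notin> {x. poly f (complex_of_real x) = 0}"
    by (intro AE_not_in finite_imp_null_set_lborel)
  with ae have "AE x in lborel. x \<notin> {-1<..<1::real}"
  proof eventually_elim
    case (elim x)
    show ?case
    proof
      assume x: "x \<in> {-1<..<1}"
      then have "1 - x\<^sup>2 > 0" by (simp add: abs_square_less_1 abs_less_iff)
      moreover have "r x \<noteq> 0" using elim(2) fr by simp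
      ultimately have "h x > 0" using x by (simp add: h_def)
      with elim(1) show False by simp
    qed
  qed
  then have "emeasure lborel {-1<..<1::real} = 0"
    by (subst (asm) AE_iff_measurable[of "{-1<..<1::real}"]) auto
  then show False by simp
qed

definition weight_poly :: "real \<Rightarrow> real \<Rightarrow> cmat_poly" where
  "weight_poly p n = vector [vector [[:complex_of_real (n - p), 0, complex_of_real p:], [:0, - complex_of_real n:]],
     vector [[:0, - complex_of_real n:], [:complex_of_real p, 0, complex_of_real (n - p):]]]"

lemma integrable_vec_components:
  fixes f :: "'a \<Rightarrow> 'b::euclidean_space ^ 'n"
  assumes "\<And>i. integrable M (\<lambda>x. f x $ i)"
  shows "integrable M f"
proof -
  have "bounded_linear (axis i :: 'b \<Rightarrow> 'b ^ 'n)" for i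
    by (intro linear_conv_bounded_linear[THEN iffD1] linearI) (auto simp: axis_def vec_eq_iff)
  then have "integrable M (\<lambda>x. \<Sum>i\<in>UNIV. axis i (f x $ i))"
    by (intro Bochner_Integration.integrable_sum integrable_bounded_linear[OF _ assms])
  moreover have "(\<lambda>x. \<Sum>i\<in>UNIV. axis i (f x $ i)) = f"
    by (auto simp: vec_eq_iff axis_def fun_eq_iff sum.delta)
  ultimately show ?thesis by simp
qed

text \<open>Reality of \<open>Q\<close> reduces the conjugate transpose to the transpose, hence the
  index order \<open>Q $ j $ l\<close>; each entry of the form becomes one scalar integral of a
  polynomial.\<close>

lemma mform_weight_component:
  assumes n: "n > 0" and Q: "\<And>j l k. coeff (Q $ j $ l) k \<in> \<real>"
  shows "mform (weight p n) P Q $ i $ j =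
    gegint n (\<Sum>l\<in>UNIV. (\<Sum>k\<in>UNIV. P $ i $ k * weight_poly p n $ k $ l) * Q $ j $ l)"
proof -
  define f where "f = (\<lambda>x. indicat_real {-1..1} x *\<^sub>R
    (eval_mpoly P x ** weight p n x ** conj_transpose (eval_mpoly Q x)))"
  define w where "w = (\<lambda>x. (1 - x\<^sup>2) powr (n / 2 - 1))"
  have wx: "w x = (1 - x\<^sup>2) powr (n / 2 - 1)" for x by (simp add: w_def)
  have W: "weight p n x $ k $ l = complex_of_real (w x) * poly (weight_poly p n $ k $ l) (complex_of_real x)" for x k l
  proof -
    have "weight p n x $ k $ l = w x *\<^sub>R poly (weight_poly p n $ k $ l) (complex_of_real x)"
      unfolding weight_def wx[symmetric] vector_scaleR_component
      using exhaust_2[of k] exhaust_2[of l]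
      by (auto simp: weight_poly_def power2_eq_square algebra_simps)
    then show ?thesis by (simp add: scaleR_conv_of_real)
  qed
  have C: "conj_transpose (eval_mpoly Q x) $ l $ j = poly (Q $ j $ l) (complex_of_real x)" for x l j
    by (simp add: conj_transpose_def transpose_def eval_mpoly_def poly_real_coeffs_of_real[OF Q])
  have E: "eval_mpoly P x $ i $ k = poly (P $ i $ k) (complex_of_real x)" for x i k
    by (simp add: eval_mpoly_def)
  have comp: "f x $ i $ j = indicat_real {-1..1} x *\<^sub>R (complex_of_real ((1 - x\<^sup>2) powr (n / 2 - 1)) *
     poly (\<Sum>l\<in>UNIV. (\<Sum>k\<in>UNIV. P $ i $ k * weight_poly p n $ k $ l) * Q $ j $ l) (complex_of_real x))" for x i j
    unfolding f_def wx[symmetric] vector_scaleR_component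
    by (rule arg_cong[of _ _ "\<lambda>z. _ *\<^sub>R z"])
       (simp add: matrix_matrix_mult_def W C E sum_2 algebra_simps)
  have "integrable lborel (\<lambda>x. f x $ i $ j)" for i j
    unfolding comp using set_integrable_geg_weight_poly[OF n] unfolding set_integrable_def .
  then have int: "integrable lborel f" "integrable lborel (\<lambda>x. f x $ i)" for i
    by (auto intro!: integrable_vec_components)
  have "mform (weight p n) P Q $ i $ j = integral\<^sup>L lborel f $ i $ j"
    by (simp add: mform_def set_lebesgue_integral_def f_def)
  also have "integral\<^sup>L lborel f $ i = integral\<^sup>L lborel (\<lambda>x. f x $ i)"
    using integral_bounded_linear[OF bounded_linear_vec_nth int(1), of i] by simp
  also have "integral\<^sup>L lborel (\<lambda>x. f x $ i) $ j = integral\<^sup>L lborel (\<lambda>x. f x $ i $ j)"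
    using integral_bounded_linear[OF bounded_linear_vec_nth int(2), of i j] by simp
  finally show ?thesis unfolding comp gegint_def set_lebesgue_integral_def .
qed

section \<open>The orthogonal polynomials of the matrix weight\<close>

definition diag2 :: "'a::zero \<Rightarrow> 'a \<Rightarrow> 'a^2^2" where
  "diag2 a b = vector [vector [a, 0], vector [0, b]]"

lemma diag2_nth [simp]:
  "diag2 a b $ 1 $ 1 = a" "diag2 a b $ 1 $ 2 = 0" "diag2 a b $ 2 $ 1 = 0" "diag2 a b $ 2 $ 2 = b"
  by (simp_all add: diag2_def)

lemmas pderiv_simps = pderiv_add pderiv_diff pderiv_minus pderiv_smult pderiv_mult pderiv_pCons

text \<open>Integration by parts in Sturm-Liouville form: up to the weight, the left side is the
  derivative of (1 - x^2)^(n/2 + 1) f' g, and the Gegenbauer equation removes f''.\<close>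

lemma geg_adj_pderiv:
  fixes n :: real and w :: nat and g :: "complex poly"
  assumes "n > -1"
  defines "f \<equiv> geg w n"
  shows "geg_adj n ([:1, 0, -1:] * (pderiv f * g)) =
    [:1, 0, -1:] * ([:1, 0, -1:] * (pderiv f * pderiv g)
      - Polynomial.smult (of_nat w * (of_nat w + of_real n + 1)) (f * g))"
proof (rule poly_eqI_points)
  fix x
  have "poly (geg_adj n ([:1, 0, -1:] * (pderiv f * g))) x =
    (1 - x\<^sup>2) * (((1 - x\<^sup>2) * poly (pderiv (pderiv f)) x) * poly g x
      + (1 - x\<^sup>2) * poly (pderiv f) x * poly (pderiv g) x - (of_real n + 2) * x * poly (pderiv f) x * poly g x)"
    by (simp add: geg_adj_def pderiv_simps algebra_simps power2_eq_square)
  also have "(1 - x\<^sup>2) * poly (pderiv (pderiv f)) x = (of_real n + 2) * x * poly (pderiv f) x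
      - of_nat w * (of_nat w + of_real n + 1) * poly f x"
    unfolding f_def by (rule poly_geg_ode[OF assms(1)])
  finally show "poly (geg_adj n ([:1, 0, -1:] * (pderiv f * g))) x =
    poly ([:1, 0, -1:] * ([:1, 0, -1:] * (pderiv f * pderiv g)
      - Polynomial.smult (of_nat w * (of_nat w + of_real n + 1)) (f * g))) x"
    by (simp add: algebra_simps power2_eq_square)
qed

text \<open>Green's identity: antisymmetrising \<open>geg_adj_pderiv\<close> cancels f' g', and the
  eigenvalues differ by (v - w)(w + v + n + 1), which is nonzero.\<close>

lemma gegint_geg_orthogonal:
  assumes n: "n > 0" and "w \<noteq> v"
  shows "gegint n ([:1, 0, -1:] * (geg w n * geg v n)) = 0"
proof -
  define l where "l = (\<lambda>w. complex_of_nat w * (of_nat w + of_real n + 1))"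
  define f where "f = geg w n"
  define g where "g = geg v n"
  have n1: "n > -1" using n by simp
  have "Polynomial.smult (l v - l w) ([:1, 0, -1:] * (f * g)) =
    geg_adj n ([:1, 0, -1:] * (pderiv f * g)) + Polynomial.smult (-1) (geg_adj n ([:1, 0, -1:] * (pderiv g * f)))"
    unfolding f_def g_def geg_adj_pderiv[OF n1] l_def
    by (rule poly_eqI_points) (simp add: algebra_simps)
  then have "(l v - l w) * gegint n ([:1, 0, -1:] * (f * g)) = 0"
    by (metis gegint_smult gegint_add[OF n] gegint_geg_adj[OF n] mult_zero_right add_0)
  moreover have "l v - l w = (of_nat v - of_nat w) * complex_of_real (real w + real v + n + 1)"
    by (simp add: l_def algebra_simps)
  moreover have "complex_of_real (real w + real v + n + 1) \<noteq> 0"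
    unfolding of_real_eq_0_iff using n by linarith
  ultimately show ?thesis using assms(2) by (simp add: f_def g_def)
qed

text \<open>With q = n - p, the assumption \<open>p < q\<close> is p < n/2.\<close>

locale gegenbauer_pair =
  fixes p q :: real
  assumes p_pos: "0 < p" and p_less_q: "p < q"
begin

definition lift :: "complex poly \<Rightarrow> cmat_poly" where
  "lift f = vector [vector [Polynomial.smult (of_real p) f + [:0, 1:] * pderiv f, pderiv f],
     vector [pderiv f, Polynomial.smult (of_real q) f + [:0, 1:] * pderiv f]]"

lemma lift_nth:
  "lift f $ 1 $ 1 = Polynomial.smult (of_real p) f + [:0, 1:] * pderiv f" "lift f $ 1 $ 2 = pderiv f"
  "lift f $ 2 $ 1 = pderiv f" "lift f $ 2 $ 2 = Polynomial.smult (of_real q) f + [:0, 1:] * pderiv f"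
  by (simp_all add: lift_def)

definition N :: "nat \<Rightarrow> cmat_poly" where
  "N w = lift (geg w (p + q))"

definition N_lead :: "nat \<Rightarrow> cmat" where
  "N_lead w = diag2 (of_nat w + of_real p) (of_nat w + of_real q)"

definition N_lead_inv :: "nat \<Rightarrow> cmat" where
  "N_lead_inv w = diag2 (1 / (of_nat w + of_real p)) (1 / (of_nat w + of_real q))"

definition Q :: "nat \<Rightarrow> cmat_poly" where
  "Q w = const_mpoly (N_lead_inv w) ** N w"

lemma q_pos: "0 < q" and n_pos: "p + q > 0" and n_gt: "p + q > -1"
  using p_pos p_less_q by auto

lemma lead_nonzero: "of_nat w + complex_of_real p \<noteq> 0" "of_nat w + complex_of_real q \<noteq> 0"
proof -
  have "complex_of_real (real w + p) \<noteq> 0" "complex_of_real (real w + q) \<noteq> 0"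
    unfolding of_real_eq_0_iff using p_pos q_pos by linarith+
  then show "of_nat w + complex_of_real p \<noteq> 0" "of_nat w + complex_of_real q \<noteq> 0" by simp_all
qed

lemma N_lead_inverse: "N_lead_inv w ** N_lead w = mat 1" "N_lead w ** N_lead_inv w = mat 1"
  by (rule matrix_eqI_2; simp add: N_lead_inv_def N_lead_def matrix_mult_nth_2 mat_nth lead_nonzero)+

lemma coeff_x_pderiv: "coeff ([:0, 1:] * pderiv f) k = of_nat k * coeff f k"
  for f :: "complex poly"
  by (cases k) (simp_all add: coeff_pderiv)

text \<open>Since y_w has no term of degree w - 1, the coefficient below the top comes from the
  off-diagonal y' alone.\<close>

lemma coeff_mpoly_N:
  shows coeff_mpoly_N_top: "coeff_mpoly (N w) w = N_lead w"
    and coeff_mpoly_N_above: "k > w \<Longrightarrow> coeff_mpoly (N w) k = 0"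
    and coeff_mpoly_N_subtop: "w \<ge> 1 \<Longrightarrow>
      coeff_mpoly (N w) (w - 1) = vector [vector [0, of_nat w], vector [of_nat w, 0]]"
  by (rule matrix_eqI_2; simp add: N_def lift_nth coeff_x_pderiv coeff_pderiv N_lead_def coeff_geg[OF n_gt] coeff_geg_subtop[OF n_gt, simplified]
        del: mult_pCons_left)+

lemma monic_Q: "monic_mpoly w (Q w)"
  by (simp add: monic_mpoly_def Q_def coeff_mpoly_const_mult coeff_mpoly_N N_lead_inverse)

lemma Q_real: "coeff (Q w $ i $ j) k \<in> \<real>"
proof -
  have "coeff (N w $ i $ j) k \<in> \<real>" for i j
    using exhaust_2[of i] exhaust_2[of j]
    by (auto simp: N_def lift_nth coeff_x_pderiv coeff_pderiv del: mult_pCons_left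
        intro!: Reals_add Reals_mult coeff_geg_real simp del: of_nat_Suc mult_pCons_left)
  moreover have "N_lead_inv w $ i $ j \<in> \<real>" for i j
    using exhaust_2[of i] exhaust_2[of j]
    by (auto simp: N_lead_inv_def intro!: Reals_divide Reals_add)
  ultimately show ?thesis
    by (auto simp: Q_def matrix_mult_nth_2 intro!: Reals_add Reals_mult)
qed

text \<open>Modulo images of \<open>geg_adj\<close>, which integrate to zero, the entries of N_w W
  N_v^T off the diagonal vanish and those on it are multiples of (1 - x^2) y_w y_v. Orthogonality
  and nondegeneracy both follow from this formula.\<close>

lemma mform_Q:
  "mform (weight p (p + q)) (Q w) (Q v) =
     N_lead_inv w ** diag2 (of_real (p * (p * (q + 1) + real w * (real w + p + q + 1))))
                      (of_real (q * (q * (p + 1) + real w * (real w + p + q + 1)))) ** N_lead_inv v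
       ** mat (gegint (p + q) ([:1, 0, -1:] * (geg w (p + q) * geg v (p + q))))"
proof -
  define f where "f = geg w (p + q)"
  define g where "g = geg v (p + q)"
  define I where "I = gegint (p + q)"
  define E where "E = (\<lambda>i j. \<Sum>l\<in>UNIV. (\<Sum>k\<in>UNIV. N w $ i $ k * weight_poly p (p + q) $ k $ l) * N v $ j $ l)"
  define l where "l = complex_of_nat w * (of_nat w + of_real (p + q) + 1)"
  define b where "b = [:1, 0, -1:] * (f * g)"
  have wp: "weight_poly p (p + q) $ 1 $ 1 = [:of_real q, 0, of_real p:]"
    "weight_poly p (p + q) $ 1 $ 2 = [:0, - of_real (p + q):]"
    "weight_poly p (p + q) $ 2 $ 1 = [:0, - of_real (p + q):]"
    "weight_poly p (p + q) $ 2 $ 2 = [:of_real p, 0, of_real q:]"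
    by (simp_all add: weight_poly_def)
  \<comment> \<open>Trades the term with f' g' in the diagonal entries for the eigenvalue
    \<open>l\<close> times \<open>b\<close>, up to an exact derivative.\<close>
  have D: "geg_adj (p + q) ([:1, 0, -1:] * (pderiv f * g)) + Polynomial.smult l b =
      [:1, 0, -1:] * ([:1, 0, -1:] * (pderiv f * pderiv g))"
    unfolding f_def geg_adj_pderiv[OF n_gt] l_def b_def by (rule poly_eqI_points) (simp add: algebra_simps)
  have E11: "E 1 1 = Polynomial.smult (of_real p) (Polynomial.smult (of_real p * (of_real q + 1)) b
      + (geg_adj (p + q) ([:1, 0, -1:] * (pderiv f * g)) + Polynomial.smult l b)
      + Polynomial.smult (- of_real p) (geg_adj (p + q) ([:0, 1:] * (f * g))))"
    unfolding D unfolding E_def sum_2 wp N_def lift_nth f_def[symmetric] g_def[symmetric] b_def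
    by (rule poly_eqI_points)
       (simp add: geg_adj_def pderiv_simps algebra_simps)
  have E22: "E 2 2 = Polynomial.smult (of_real q) (Polynomial.smult (of_real q * (of_real p + 1)) b
      + (geg_adj (p + q) ([:1, 0, -1:] * (pderiv f * g)) + Polynomial.smult l b)
      + Polynomial.smult (- of_real q) (geg_adj (p + q) ([:0, 1:] * (f * g))))"
    unfolding D unfolding E_def sum_2 wp N_def lift_nth f_def[symmetric] g_def[symmetric] b_def
    by (rule poly_eqI_points)
       (simp add: geg_adj_def pderiv_simps algebra_simps)
  have E12: "E 1 2 = Polynomial.smult (of_real p * of_real q) (geg_adj (p + q) (f * g))"
    unfolding E_def sum_2 wp N_def lift_nth f_def[symmetric] g_def[symmetric]
    by (rule poly_eqI_points) (simp add: geg_adj_def pderiv_simps algebra_simps)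
  have E21: "E 2 1 = Polynomial.smult (of_real p * of_real q) (geg_adj (p + q) (f * g))"
    unfolding E_def sum_2 wp N_def lift_nth f_def[symmetric] g_def[symmetric]
    by (rule poly_eqI_points) (simp add: geg_adj_def pderiv_simps algebra_simps)
  have IE11: "I (E 1 1) = of_real p * (of_real p * (of_real q + 1) + l) * I b"
    and IE22: "I (E 2 2) = of_real q * (of_real q * (of_real p + 1) + l) * I b"
    and IE12: "I (E 1 2) = 0" and IE21: "I (E 2 1) = 0"
    unfolding E11 E22 E12 E21 I_def gegint_smult gegint_add[OF n_pos] gegint_geg_adj[OF n_pos]
    by (simp_all add: algebra_simps)
  have "mform (weight p (p + q)) (Q w) (Q v) $ i $ j = N_lead_inv w $ i $ i * N_lead_inv v $ j $ j * I (E i j)" for i j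
  proof -
    have Qn: "Q w $ i $ k = Polynomial.smult (N_lead_inv w $ i $ i) (N w $ i $ k)" for w i k
      using exhaust_2[of i] by (auto simp: Q_def matrix_mult_nth_2 N_lead_inv_def)
    have "(\<Sum>l\<in>UNIV. (\<Sum>k\<in>UNIV. Q w $ i $ k * weight_poly p (p + q) $ k $ l) * Q v $ j $ l) =
       Polynomial.smult (N_lead_inv w $ i $ i * N_lead_inv v $ j $ j) (E i j)"
      unfolding Qn E_def sum_2 by (rule poly_eqI_points) (simp add: algebra_simps)
    then show ?thesis
      unfolding mform_weight_component[OF n_pos Q_real] by (simp add: I_def gegint_smult)
  qed
  note comp = this
  show ?thesis
    unfolding f_def[symmetric] g_def[symmetric] b_def[symmetric] I_def[symmetric]
    by (intro matrix_eqI_2; unfold comp IE11 IE22 IE12 IE21)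
       (simp_all add: matrix_mult_nth_2 mat_nth N_lead_inv_def l_def)
qed

lemma mform_Q_orthogonal:
  assumes "w \<noteq> v"
  shows "mform (weight p (p + q)) (Q w) (Q v) = 0"
  unfolding mform_Q gegint_geg_orthogonal[OF n_pos assms]
  by (intro matrix_eqI_2) (simp_all add: matrix_mult_nth_2 mat_nth)

text \<open>The squared norm of \<open>Q w\<close> is a diagonal matrix with nonzero entries, so it
  can be cancelled in the uniqueness argument.\<close>

lemma mform_Q_nondegenerate:
  fixes A :: cmat
  assumes "A ** mform (weight p (p + q)) (Q w) (Q w) = 0"
  shows "A = 0"
proof -
  have "geg w (p + q) \<noteq> 0" using coeff_geg_top[OF n_gt, of w] by auto
  then have g: "gegint (p + q) ([:1, 0, -1:] * (geg w (p + q) * geg w (p + q))) \<noteq> 0"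
    by (rule gegint_square_nonzero[OF n_pos]) (rule coeff_geg_real)
  have "0 < p * (p * (q + 1) + real w * (real w + p + q + 1))"
    "0 < q * (q * (p + 1) + real w * (real w + p + q + 1))"
    using p_pos q_pos by (intro mult_pos_pos add_pos_nonneg mult_nonneg_nonneg; simp)+
  then have pos: "complex_of_real (p * (p * (q + 1) + real w * (real w + p + q + 1))) \<noteq> 0"
    "complex_of_real (q * (q * (p + 1) + real w * (real w + p + q + 1))) \<noteq> 0"
    unfolding of_real_eq_0_iff by linarith+
  define c where "c = gegint (p + q) ([:1, 0, -1:] * (geg w (p + q) * geg w (p + q)))"
  define d1 where "d1 = complex_of_real (p * (p * (q + 1) + real w * (real w + p + q + 1)))"
  define d2 where "d2 = complex_of_real (q * (q * (p + 1) + real w * (real w + p + q + 1)))"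
  have "(A ** mform (weight p (p + q)) (Q w) (Q w)) $ i $ j = 0" for i j
    unfolding assms by simp
  from this[of 1 1] this[of 1 2] this[of 2 1] this[of 2 2] show ?thesis
    using g pos lead_nonzero[of w]
    unfolding mform_Q d1_def[symmetric] d2_def[symmetric] c_def[symmetric]
    by (intro matrix_eqI_2) (auto simp: matrix_mult_nth_2 mat_nth N_lead_inv_def)
qed

section \<open>Uniqueness of the monic orthogonal sequence\<close>

lemma mform_add_left: "mform (weight p (p + q)) (P + P') (Q w) = 
    mform (weight p (p + q)) P (Q w) + mform (weight p (p + q)) P' (Q w)"
proof -
  have "mform (weight p (p + q)) (P + P') (Q w) $ i $ j = (mform (weight p (p + q)) P (Q w)
      + mform (weight p (p + q)) P' (Q w)) $ i $ j" for i j
    unfolding vector_add_component mform_weight_component[OF n_pos Q_real] gegint_add[OF n_pos, symmetric]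
    by (rule arg_cong[of _ _ "gegint (p + q)"]) (simp add: sum_2 algebra_simps)
  then show ?thesis by (simp add: vec_eq_iff)
qed

lemma mform_const_left: "mform (weight p (p + q)) (const_mpoly A ** P) (Q w) =
    A ** mform (weight p (p + q)) P (Q w)"
proof -
  have "mform (weight p (p + q)) (const_mpoly A ** P) (Q w) $ i $ j = (A ** mform (weight p (p + q)) P (Q w)) $ i $ j" for i j
    unfolding matrix_mult_nth_2 mform_weight_component[OF n_pos Q_real] gegint_smult[symmetric] gegint_add[OF n_pos, symmetric]
    by (rule arg_cong[of _ _ "gegint (p + q)"], rule poly_eqI_points) (simp add: sum_2 matrix_mult_nth_2 algebra_simps)
  then show ?thesis by (simp add: vec_eq_iff)
qed

lemma mform_sum_left: "mform (weight p (p + q)) (\<Sum>k\<in>S. const_mpoly (A k) ** Q k) (Q w) =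
    (\<Sum>k\<in>S. A k ** mform (weight p (p + q)) (Q k) (Q w))"
proof -
  have "mform (weight p (p + q)) 0 (Q w) = 0"
    using mform_const_left[of 0 0 w] by (simp add: vec_eq_iff matrix_mult_nth_2)
  then show ?thesis
    by (induction S rule: infinite_finite_induct) (simp_all add: mform_add_left mform_const_left)
qed

text \<open>For uniqueness, the difference of two candidates of degree w has lower degree. Expanded
  in the earlier \<open>Q k\<close> and paired with each \<open>Q j\<close>, it has zero
  coefficients.\<close>

lemma monic_orthogonal_eq: "monic_orthogonal (weight p (p + q)) = Q"
  unfolding monic_orthogonal_def
proof (rule the_equality)
  show "is_monic_orthogonal (weight p (p + q)) Q"
    by (simp add: is_monic_orthogonal_def monic_Q mform_Q_orthogonal)
  fix R assume R: "is_monic_orthogonal (weight p (p + q)) R"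
  have "R w = Q w" for w
  proof (induction w rule: less_induct)
    case (less w)
    have "coeff_mpoly (R w - Q w) k = 0" if "k \<ge> w" for k
      using R monic_Q[of w] that unfolding is_monic_orthogonal_def monic_mpoly_def coeff_mpoly_diff
      by (cases "k = w") auto
    from monic_span[of Q, OF monic_Q this]
    obtain A where A: "R w - Q w = (\<Sum>k<w. const_mpoly (A k) ** Q k)" by blast
    have "A j = 0" if "j < w" for j
    proof -
      \<comment> \<open>By induction \<open>Q j\<close> is \<open>R j\<close>, so this is
        orthogonality within \<open>R\<close>.\<close>
      have "mform (weight p (p + q)) (R w) (Q j) = 0"
        using R less[OF that] that unfolding is_monic_orthogonal_def by (metis less_irrefl)
      moreover have "R w = (\<Sum>k<w. const_mpoly (A k) ** Q k) + Q w" using A by (simp add: algebra_simps)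
      ultimately have "(\<Sum>k<w. A k ** mform (weight p (p + q)) (Q k) (Q j)) + mform (weight p (p + q)) (Q w) (Q j) = 0"
        by (simp add: mform_add_left mform_sum_left)
      moreover have "(\<Sum>k<w. A k ** mform (weight p (p + q)) (Q k) (Q j)) =
         (\<Sum>k\<in>{j}. A k ** mform (weight p (p + q)) (Q k) (Q j))"
        using that by (intro sum.mono_neutral_right)
          (auto simp: mform_Q_orthogonal vec_eq_iff matrix_mult_nth_2)
      ultimately have "A j ** mform (weight p (p + q)) (Q j) (Q j) = 0"
        using that mform_Q_orthogonal[of w j] by simp
      then show ?thesis by (rule mform_Q_nondegenerate)
    qed
    then have "R w - Q w = 0" unfolding A
      by (intro sum.neutral) (simp add: vec_eq_iff matrix_mult_nth_2)
    then show ?case by simp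
  qed
  then show "R = Q" by auto
qed

end

section \<open>Necessary conditions on the eigenvalues\<close>

text \<open>Equivalently, the scalar matrices plus the right ideal diag(t - 1, t) M_2(C[t]).\<close>

definition model :: "cmat_poly set" where
  "model = {M. poly (M $ 1 $ 1) 1 = poly (M $ 2 $ 2) 0 \<and> poly (M $ 1 $ 2) 1 = 0 \<and> poly (M $ 2 $ 1) 0 = 0}"

lemma poly_eqI_naturals:
  fixes f g :: "complex poly"
  assumes "\<And>w. w \<ge> 1 \<Longrightarrow> poly f (of_nat w) = poly g (of_nat w)"
  shows "f = g"
proof (rule ccontr)
  assume "f \<noteq> g"
  then have "finite {x. poly (f - g) x = 0}" by (intro poly_roots_finite) simp
  moreover have "of_nat ` {1..} \<subseteq> {x. poly (f - g) x = 0}" using assms by auto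
  ultimately have "finite (of_nat ` {1..} :: complex set)" using finite_subset by blast
  moreover have "inj_on (of_nat :: nat \<Rightarrow> complex) {1..}" by (simp add: inj_on_def)
  ultimately have "finite {1::nat..}" using finite_imageD by blast
  then show False by (simp add: infinite_Ici)
qed

text \<open>The combinations of y_w and its derivatives whose coefficients in C[x] are the same for
  all \<open>w\<close>. The entries of N_w D are of this kind.\<close>

inductive geg_module :: "real \<Rightarrow> (nat \<Rightarrow> complex poly) \<Rightarrow> bool" for n where
  deriv: "geg_module n (\<lambda>w. (pderiv ^^ m) (geg w n))"
| add: "geg_module n X \<Longrightarrow> geg_module n Y \<Longrightarrow> geg_module n (\<lambda>w. X w + Y w)"
| mult: "geg_module n X \<Longrightarrow> geg_module n (\<lambda>w. g * X w)"

lemma geg_module_pderiv: "geg_module n X \<Longrightarrow> geg_module n (\<lambda>w. pderiv (X w))"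
proof (induction rule: geg_module.induct)
  case (deriv m)
  show ?case using geg_module.deriv[of n "Suc m"] by simp
next
  case (add X Y)
  then show ?case by (simp add: pderiv_add geg_module.add)
next
  case (mult X g)
  have "geg_module n (\<lambda>w. g * pderiv (X w) + pderiv g * X w)"
    using mult by (intro geg_module.add geg_module.mult)
  then show ?case by (simp add: pderiv_mult mult.commute)
qed

lemma geg_module_higher_pderiv: "geg_module n X \<Longrightarrow> geg_module n (\<lambda>w. (pderiv ^^ m) (X w))"
  by (induction m) (simp_all add: geg_module_pderiv)

lemma geg_module_sum: "(\<And>i. i \<in> S \<Longrightarrow> geg_module n (X i)) \<Longrightarrow> geg_module n (\<lambda>w. \<Sum>i\<in>S. X i w)"
proof (induction S rule: infinite_finite_induct)
  case (insert i S)
  then show ?case by (simp add: geg_module.add)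
qed (use geg_module.mult[OF geg_module.deriv, of n 0] in simp_all)

context gegenbauer_pair
begin

text \<open>
  The eigenvalue of \<open>geg w (p + q)\<close> under the Gegenbauer operator, normalised affinely so that its two
  special values, at \<open>w = -p\<close> and at \<open>w = -q\<close>, are 1 and 0.
\<close>

definition spec_poly :: "complex poly" where
  "spec_poly = Polynomial.smult (1 / (of_real q - of_real p)) ([:of_real p + 1, 1:] * [:of_real q, 1:])"

definition spec :: "nat \<Rightarrow> complex" where
  "spec w = poly spec_poly (of_nat w)"

section \<open>The spectral parameter and endpoint values\<close>

lemma p_neq: "complex_of_real p \<noteq> 0" "complex_of_real q \<noteq> 0" "complex_of_real q - complex_of_real p \<noteq> 0"
  using p_pos q_pos p_less_q by auto

lemma poly_spec_poly: "poly spec_poly x = (x + of_real p + 1) * (x + of_real q) / (of_real q - of_real p)"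
  by (simp only: spec_poly_def poly_smult poly_mult) (simp add: add_ac)

text \<open>The value at -1 - p serves the coefficient relation that involves w - 1, evaluated at w
  = -p.\<close>

lemma spec_poly_values:
  "poly spec_poly (- of_real p) = 1" "poly spec_poly (- 1 - of_real p) = 0" "poly spec_poly (- of_real q) = 0"
  using p_neq by (simp_all add: poly_spec_poly)

lemma spec_eq: "(of_real q - of_real p) * spec w = (of_nat w + of_real p + 1) * (of_nat w + of_real q)"
  using p_neq by (simp add: spec_def poly_spec_poly)

text \<open>\<open>spec_poly\<close> is nonconstant, so composition with it is injective on
  polynomials.\<close>

lemma poly_eqI_spec:
  assumes "\<And>w. poly f (spec w) = poly g (spec w)"
  shows "f = g"
proof -
  have "pcompose (f - g) spec_poly = 0"
    using assms by (intro poly_eqI_naturals) (simp add: poly_pcompose spec_def)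
  moreover have "degree spec_poly = 2"
    unfolding spec_poly_def using p_neq by (simp add: degree_mult_eq)
  ultimately show ?thesis using pcompose_eq_0 by fastforce
qed

text \<open>The constant q (p + 1) is the difference between (w + p + 1)(w + q) and w (w + p + q +
  1).\<close>

lemma geg_endpoint_first:
  assumes "e\<^sup>2 = 1"
  shows "(of_real p + of_real q + 2) * poly (pderiv (geg w (p + q))) e =
     e * ((of_real q - of_real p) * spec w - of_real q * (of_real p + 1)) * poly (geg w (p + q)) e"
  using geg_endpoint_deriv[OF n_gt assms, of 0 w] unfolding spec_eq by (simp add: algebra_simps)

text \<open>Each further derivative contributes a factor linear in \<open>spec w\<close> by the
  endpoint recurrence, and a coefficient \<open>g\<close> contributes only the number g(e).\<close>

lemma geg_module_endpoint:
  assumes X: "geg_module (p + q) X" and e: "e\<^sup>2 = 1"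
  shows "\<exists>s. \<forall>w. poly (X w) e = poly (geg w (p + q)) e * poly s (spec w)"
  using X
proof induction
  case (deriv m)
  show ?case
  proof (induction m)
    case 0
    show ?case by (rule exI[of _ 1]) simp
  next
    case (Suc m)
    then obtain s where s: "\<And>w. poly ((pderiv ^^ m) (geg w (p + q))) e = poly (geg w (p + q)) e * poly s (spec w)"
      by blast
    define k where "k = complex_of_real (p + q) + 2 + 2 * of_nat m"
    \<comment> \<open>Chosen so that the factor in \<open>geg_endpoint_deriv\<close> reads (q - p)
      \<open>spec w\<close> - \<open>c\<close>.\<close>
    define c where "c = of_real q * (of_real p + 1) + of_nat m * (of_nat m + complex_of_real (p + q) + 1)"
    have "k = complex_of_real (p + q + 2 + 2 * real m)" by (simp add: k_def)
    then have k0: "k \<noteq> 0" using n_pos by (metis of_real_eq_0_iff add_pos_nonneg less_irrefl mult_nonneg_nonneg of_nat_0_le_iff zero_le_numeral add_pos_pos zero_less_numeral)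
    have "poly ((pderiv ^^ Suc m) (geg w (p + q))) e =
       poly (geg w (p + q)) e * poly (Polynomial.smult (e / k) ([:- c, of_real q - of_real p:] * s)) (spec w)" for w
    proof -
      have "of_nat w * (of_nat w + complex_of_real (p + q) + 1) - of_nat m * (of_nat m + complex_of_real (p + q) + 1)
        = (of_real q - of_real p) * spec w - c"
        unfolding spec_eq c_def by (simp add: algebra_simps)
      then have "k * poly ((pderiv ^^ Suc m) (geg w (p + q))) e =
         e * ((of_real q - of_real p) * spec w - c) * (poly (geg w (p + q)) e * poly s (spec w))"
        using geg_endpoint_deriv[OF n_gt e, of m w] unfolding s k_def by (simp only:)
      then show ?thesis using k0 by (simp add: field_simps del: funpow.simps)
    qed
    then show ?case by blast
  qed
next
  case (add X Y)
  then obtain s t where "\<And>w. poly (X w) e = poly (geg w (p + q)) e * poly s (spec w)"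
    "\<And>w. poly (Y w) e = poly (geg w (p + q)) e * poly t (spec w)" by blast
  then show ?case by (intro exI[of _ "s + t"]) (simp add: algebra_simps)
next
  case (mult X g)
  then obtain s where "\<And>w. poly (X w) e = poly (geg w (p + q)) e * poly s (spec w)" by blast
  then show ?case by (intro exI[of _ "Polynomial.smult (poly g e) s"]) simp
qed

lemma geg_module_N: "geg_module (p + q) (\<lambda>w. N w $ i $ j)"
proof -
  have 0: "geg_module (p + q) (\<lambda>w. geg w (p + q))"
    using geg_module.deriv[of "p + q" 0] by simp
  have 1: "geg_module (p + q) (\<lambda>w. pderiv (geg w (p + q)))" by (rule geg_module_pderiv[OF 0])
  have 2: "geg_module (p + q) (\<lambda>w. Polynomial.smult c (geg w (p + q)) + [:0, 1:] * pderiv (geg w (p + q)))" for c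
    using geg_module.add[OF geg_module.mult[OF 0, of "[:c:]"] geg_module.mult[OF 1, of "[:0, 1:]"]] by simp
  show ?thesis
    using exhaust_2[of i] exhaust_2[of j] 1 2 by (auto simp: N_def lift_nth simp del: mult_pCons_left)
qed

lemma diff_op_N_endpoint:
  assumes "D \<in> diff_ops" "e\<^sup>2 = 1"
  shows "\<exists>s. \<forall>w. poly (D (N w) $ i $ j) e = poly (geg w (p + q)) e * poly s (spec w)"
proof -
  obtain s F where D: "D = diff_op s F" using assms by (auto simp: diff_ops_def)
  have "D (N w) $ i $ j = (\<Sum>m\<le>s. F m $ 1 $ j * (pderiv ^^ m) (N w $ i $ 1) + F m $ 2 $ j * (pderiv ^^ m) (N w $ i $ 2))" for w
    by (simp add: D diff_op_def matrix_mult_nth_2 mult.commute)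
  moreover have "geg_module (p + q) (\<lambda>w. \<Sum>m\<le>s. F m $ 1 $ j * (pderiv ^^ m) (N w $ i $ 1) + F m $ 2 $ j * (pderiv ^^ m) (N w $ i $ 2))"
    by (intro geg_module_sum geg_module.add geg_module.mult geg_module_higher_pderiv geg_module_N)
  ultimately have "geg_module (p + q) (\<lambda>w. D (N w) $ i $ j)" by simp
  then show ?thesis using assms(2) by (rule geg_module_endpoint)
qed

text \<open>Evaluating the eigenvalue equation at both endpoints and dividing by the nonzero y_w(e)
  gives linear equations for each row of \<open>L w\<close>, with right sides polynomial in
  \<open>spec w\<close>.\<close>

lemma eigenvalue_polynomial:
  assumes D: "D \<in> diff_ops" and L: "\<And>w. D (N w) = const_mpoly (L w) ** N w"
  obtains M where "\<And>w. L w = eval_at (spec w) M"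
proof -
  have "\<forall>e i j. \<exists>s. e\<^sup>2 = 1 \<longrightarrow> (\<forall>w. poly (D (N w) $ i $ j) e = poly (geg w (p + q)) e * poly s (spec w))"
    using diff_op_N_endpoint[OF D] by blast
  then obtain S where S: "\<And>e i j w. e\<^sup>2 = 1 \<Longrightarrow>
      poly (D (N w) $ i $ j) e = poly (geg w (p + q)) e * poly (S e i j) (spec w)"
    by metis
  \<comment> \<open>The logarithmic derivative of y_w at 1; at -1 it is the negative of
    this.\<close>
  define r where "r = (\<lambda>w. ((of_real q - of_real p) * spec w - of_real q * (of_real p + 1)) / (of_real p + of_real q + 2))"
  have n2: "of_real p + of_real q + 2 \<noteq> (0::complex)"
  proof -
    have "complex_of_real (p + q + 2) \<noteq> 0" unfolding of_real_eq_0_iff using n_pos by linarith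
    then show ?thesis by simp
  qed
  have dy: "poly (pderiv (geg w (p + q))) e = e * r w * poly (geg w (p + q)) e" if "e\<^sup>2 = 1" for e w
    using geg_endpoint_first[OF that, of w] n2 by (simp add: r_def field_simps)
  have E: "L w $ i $ 1 * (of_real p + r w) + L w $ i $ 2 * (e * r w) = poly (S e i 1) (spec w) \<and>
      L w $ i $ 1 * (e * r w) + L w $ i $ 2 * (of_real q + r w) = poly (S e i 2) (spec w)" if e: "e\<^sup>2 = 1" for e w i
  proof -
    define y where "y = poly (geg w (p + q)) e"
    have y0: "y \<noteq> 0" unfolding y_def by (rule poly_geg_endpoint[OF n_gt e])
    have ee: "e * (e * c) = c" for c using e by (simp add: power2_eq_square mult.assoc[symmetric])
    have "y * (L w $ i $ 1 * (of_real p + r w) + L w $ i $ 2 * (e * r w)) = y * poly (S e i 1) (spec w)"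
      unfolding S[OF e, of w i 1, folded y_def, symmetric] L
      by (simp add: matrix_mult_nth_2 N_def lift_nth dy[OF e] y_def[symmetric] ee algebra_simps)
    moreover have "y * (L w $ i $ 1 * (e * r w) + L w $ i $ 2 * (of_real q + r w)) = y * poly (S e i 2) (spec w)"
      unfolding S[OF e, of w i 2, folded y_def, symmetric] L
      by (simp add: matrix_mult_nth_2 N_def lift_nth dy[OF e] y_def[symmetric] ee algebra_simps)
    ultimately show ?thesis using y0 by simp
  qed
  (* p L_i1 and q L_i2 are linear combinations of the four values at x = 1 and x = -1, so no division
     by the non-constant determinant of N w at an endpoint is needed. *)
  define M :: cmat_poly where "M = (\<chi> i j. if j = 1
     then Polynomial.smult (1 / (2 * of_real p)) (S 1 i 1 + S (-1) i 1 - S 1 i 2 + S (-1) i 2)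
     else Polynomial.smult (1 / (2 * of_real q)) (S 1 i 2 + S (-1) i 2 - S 1 i 1 + S (-1) i 1))"
  have "L w = eval_at (spec w) M" for w
  proof -
    have E': "poly (S 1 i 1) (spec w) = L w $ i $ 1 * (of_real p + r w) + L w $ i $ 2 * r w"
      "poly (S 1 i 2) (spec w) = L w $ i $ 1 * r w + L w $ i $ 2 * (of_real q + r w)"
      "poly (S (-1) i 1) (spec w) = L w $ i $ 1 * (of_real p + r w) - L w $ i $ 2 * r w"
      "poly (S (-1) i 2) (spec w) = L w $ i $ 2 * (of_real q + r w) - L w $ i $ 1 * r w" for i
      using E[of 1 w i] E[of "-1" w i] by (simp_all del: poly_1)
    have "L w $ i $ 1 = poly (M $ i $ 1) (spec w)" for i
    proof -
      have "poly (S 1 i 1 + S (-1) i 1 - S 1 i 2 + S (-1) i 2) (spec w) = 2 * of_real p * L w $ i $ 1"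
        unfolding poly_add poly_diff E' by (simp add: algebra_simps)
      then show ?thesis using p_neq by (simp add: M_def)
    qed
    moreover have "L w $ i $ 2 = poly (M $ i $ 2) (spec w)" for i
    proof -
      have "poly (S 1 i 2 + S (-1) i 2 - S 1 i 1 + S (-1) i 1) (spec w) = 2 * of_real q * L w $ i $ 2"
        unfolding poly_add poly_diff E' by (simp add: algebra_simps)
      then show ?thesis using p_neq by (simp add: M_def)
    qed
    ultimately show ?thesis by (intro matrix_eqI_2) simp_all
  qed
  then show ?thesis by (rule that)
qed

text \<open>Passing between \<open>Q w\<close> and \<open>N w\<close> conjugates the eigenvalue by
  the invertible \<open>N_lead w\<close>, which does not affect its existence.\<close>

lemma D_set_iff:
  "D \<in> D_set (weight p (p + q)) \<longleftrightarrow> D \<in> diff_ops \<and> (\<forall>w. \<exists>L. D (N w) = const_mpoly L ** N w)"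
proof -
  have "(\<exists>L. D (Q w) = const_mpoly L ** Q w) \<longleftrightarrow> (\<exists>L. D (N w) = const_mpoly L ** N w)"
    if "D \<in> diff_ops" for w
  proof
    have N: "N w = const_mpoly (N_lead w) ** Q w"
      by (simp add: Q_def matrix_mul_assoc const_mpoly_mult[symmetric] N_lead_inverse)
    note lin = left_linear_const[OF diff_ops_left_linear[OF that]]
    {
      assume "\<exists>L. D (Q w) = const_mpoly L ** Q w"
      then obtain L where "D (Q w) = const_mpoly L ** Q w" by blast
      then have "D (N w) = const_mpoly (N_lead w ** L ** N_lead_inv w) ** N w"
        by (subst N, subst lin) (simp add: const_mpoly_mult Q_def matrix_mul_assoc)
      then show "\<exists>L. D (N w) = const_mpoly L ** N w" by blast
    next
      assume "\<exists>L. D (N w) = const_mpoly L ** N w"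
      then obtain L where "D (N w) = const_mpoly L ** N w" by blast
      then have "D (Q w) = const_mpoly (N_lead_inv w ** L ** N_lead w) ** Q w"
        unfolding Q_def lin by (simp add: const_mpoly_mult[symmetric] matrix_mul_assoc N_lead_inverse)
          (simp add: matrix_mul_assoc[symmetric] N_lead_inverse)
      then show "\<exists>L. D (Q w) = const_mpoly L ** Q w" by blast
    }
  qed
  then show ?thesis by (auto simp: D_set_def monic_orthogonal_eq)
qed

text \<open>The two top coefficients of N_w D are computed from the eigenvalue and again from the
  action on monomials. Each resulting identity holds for all w >= 1, hence between
  polynomials.\<close>

lemma eigenvalue_model:
  assumes D: "D \<in> diff_ops" and DN: "\<And>w. D (N w) = const_mpoly (eval_at (spec w) M) ** N w"
  shows "M \<in> model"
proof -
  note lin = diff_ops_left_linear[OF D]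
  define X where "X = (\<lambda>k. mat (monom 1 k) :: cmat_poly)"
  have X: "coeff_mpoly (X k) m = (if m = k then mat 1 else 0)" for k m
    by (intro matrix_eqI_2) (simp_all add: X_def mat_nth)
  have "\<exists>L. D (Q w) = const_mpoly L ** Q w" for w
    using D_set_iff[of D] D DN by (auto simp: D_set_def monic_orthogonal_eq)
  then obtain L where L: "\<And>w. D (Q w) = const_mpoly (L w) ** Q w" by metis
  note deg = left_linear_degree[OF lin monic_Q L]
  obtain A where A: "\<And>k. coeff_mpoly (D (X k)) k = eval_at (of_nat k) A"
    using diff_op_monom_coeff(1)[OF D] unfolding X_def by blast
  obtain B where B: "\<And>k. k \<ge> 1 \<Longrightarrow> coeff_mpoly (D (X k)) (k - 1) = eval_at (of_nat k) B"
    using diff_op_monom_coeff(2)[OF D] unfolding X_def by blast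
  define C :: "nat \<Rightarrow> cmat" where "C = (\<lambda>w. vector [vector [0, of_nat w], vector [of_nat w, 0]])"
  have C: "C w $ 1 $ 1 = 0" "C w $ 1 $ 2 = of_nat w" "C w $ 2 $ 1 = of_nat w" "C w $ 2 $ 2 = 0" for w
    by (simp_all add: C_def)
  have top: "eval_at (spec w) M ** N_lead w = N_lead w ** eval_at (of_nat w) A"
    and sub: "eval_at (spec w) M ** C w = N_lead w ** eval_at (of_nat w) B + C w ** eval_at (of_nat (w - 1)) A"
    if w: "w \<ge> 1" for w
  proof -
    \<comment> \<open>The part of \<open>N w\<close> of degree below w - 1; \<open>D\<close> keeps
      it there, so it does not affect the two coefficients compared.\<close>
    define R where "R = N w - (const_mpoly (N_lead w) ** X w + const_mpoly (C w) ** X (w - 1))"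
    have R: "coeff_mpoly R k = 0" if k: "k \<ge> w - 1" for k
    proof -
      consider "k = w" | "k = w - 1" "k \<noteq> w" | "k > w" using k w by linarith
      then show ?thesis
        by cases (use w in \<open>auto simp: R_def coeff_mpoly_diff coeff_mpoly_add coeff_mpoly_const_mult X
            coeff_mpoly_N_top coeff_mpoly_N_above coeff_mpoly_N_subtop[simplified] C_def vec_eq_iff matrix_mult_nth_2\<close>)
    qed
    have "N w = const_mpoly (N_lead w) ** X w + const_mpoly (C w) ** X (w - 1) + R" by (simp add: R_def)
    then have DN': "D (N w) = const_mpoly (N_lead w) ** D (X w) + const_mpoly (C w) ** D (X (w - 1)) + D R"
      by (simp only: left_linear_add[OF lin] left_linear_const[OF lin])
    have DR: "coeff_mpoly (D R) k = 0" if "k \<ge> w - 1" for k using deg[of "w - 1" R k] R that by blast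
    have "coeff_mpoly (D (X (w - 1))) w = 0" using w by (intro deg[of w]) (auto simp: X)
    then have "coeff_mpoly (D (N w)) w = N_lead w ** eval_at (of_nat w) A"
      unfolding DN' coeff_mpoly_add coeff_mpoly_const_mult A using w
      by (simp add: DR vec_eq_iff matrix_mult_nth_2)
    then show "eval_at (spec w) M ** N_lead w = N_lead w ** eval_at (of_nat w) A"
      by (simp add: DN coeff_mpoly_const_mult coeff_mpoly_N_top)
    have "coeff_mpoly (D (N w)) (w - 1) = N_lead w ** eval_at (of_nat w) B + C w ** eval_at (of_nat (w - 1)) A"
      unfolding DN' coeff_mpoly_add coeff_mpoly_const_mult A B[OF w] by (simp add: DR)
    then show "eval_at (spec w) M ** C w = N_lead w ** eval_at (of_nat w) B + C w ** eval_at (of_nat (w - 1)) A"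
      unfolding DN coeff_mpoly_const_mult coeff_mpoly_N_subtop[OF w] C_def .
  qed
  \<comment> \<open>On the diagonal both sides carry the same factor w + q, which cancels; thus
    \<open>A $ 2 $ 2\<close> is known in terms of \<open>M\<close>.\<close>
  have A22: "A $ 2 $ 2 = pcompose (M $ 2 $ 2) spec_poly"
  proof (rule poly_eqI_naturals)
    fix w :: nat assume w: "w \<ge> 1"
    have "(eval_at (spec w) M ** N_lead w) $ 2 $ 2 = (N_lead w ** eval_at (of_nat w) A) $ 2 $ 2"
      using top[OF w] by simp
    then show "poly (A $ 2 $ 2) (of_nat w) = poly (pcompose (M $ 2 $ 2) spec_poly) (of_nat w)"
      using lead_nonzero[of w] by (simp add: matrix_mult_nth_2 N_lead_def poly_pcompose spec_def mult.commute)
  qed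
  have "pcompose (M $ 1 $ 2) spec_poly * [:of_real q, 1:] = [:of_real p, 1:] * A $ 1 $ 2"
  proof (rule poly_eqI_naturals)
    fix w :: nat assume w: "w \<ge> 1"
    have "(eval_at (spec w) M ** N_lead w) $ 1 $ 2 = (N_lead w ** eval_at (of_nat w) A) $ 1 $ 2"
      using top[OF w] by simp
    then show "poly (pcompose (M $ 1 $ 2) spec_poly * [:of_real q, 1:]) (of_nat w) = poly ([:of_real p, 1:] * A $ 1 $ 2) (of_nat w)"
      by (simp add: matrix_mult_nth_2 N_lead_def poly_pcompose spec_def algebra_simps)
  qed
  \<comment> \<open>At w = -p the right side vanishes, while the factor on the left becomes q -
    p.\<close>
  from arg_cong[OF this, of "\<lambda>f. poly f (- of_real p)"] have M12: "poly (M $ 1 $ 2) 1 = 0"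
    using p_neq by (simp add: poly_pcompose spec_poly_values)
  have "pcompose (M $ 2 $ 1) spec_poly * [:of_real p, 1:] = [:of_real q, 1:] * A $ 2 $ 1"
  proof (rule poly_eqI_naturals)
    fix w :: nat assume w: "w \<ge> 1"
    have "(eval_at (spec w) M ** N_lead w) $ 2 $ 1 = (N_lead w ** eval_at (of_nat w) A) $ 2 $ 1"
      using top[OF w] by simp
    then show "poly (pcompose (M $ 2 $ 1) spec_poly * [:of_real p, 1:]) (of_nat w) = poly ([:of_real q, 1:] * A $ 2 $ 1) (of_nat w)"
      by (simp add: matrix_mult_nth_2 N_lead_def poly_pcompose spec_def algebra_simps)
  qed
  \<comment> \<open>The mirror case: at w = -q the right side vanishes and the left factor is p -
    q.\<close>
  from arg_cong[OF this, of "\<lambda>f. poly f (- of_real q)"] have M21: "poly (M $ 2 $ 1) 0 = 0"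
    using p_neq by (simp add: poly_pcompose spec_poly_values)
  have "pcompose (M $ 1 $ 1) spec_poly * [:0, 1:] = [:of_real p, 1:] * B $ 1 $ 2
     + [:0, 1:] * pcompose (pcompose (M $ 2 $ 2) spec_poly) [:-1, 1:]"
  proof (rule poly_eqI_naturals)
    fix w :: nat assume w: "w \<ge> 1"
    have "(eval_at (spec w) M ** C w) $ 1 $ 2 = (N_lead w ** eval_at (of_nat w) B + C w ** eval_at (of_nat (w - 1)) A) $ 1 $ 2"
      using sub[OF w] by simp
    moreover have e: "(of_nat (w - 1) :: complex) = of_nat w - 1" using w by (simp add: of_nat_diff)
    ultimately show "poly (pcompose (M $ 1 $ 1) spec_poly * [:0, 1:]) (of_nat w) =
      poly ([:of_real p, 1:] * B $ 1 $ 2 + [:0, 1:] * pcompose (pcompose (M $ 2 $ 2) spec_poly) [:-1, 1:]) (of_nat w)"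
      unfolding e by (simp add: matrix_mult_nth_2 N_lead_def C A22 poly_pcompose spec_def algebra_simps)
  qed
  \<comment> \<open>At w = -p the unknown \<open>B\<close> drops out; the common factor -p cancels,
    and the shifted argument -1 - p gives t = 0 in \<open>M $ 2 $ 2\<close>.\<close>
  from arg_cong[OF this, of "\<lambda>f. poly f (- of_real p)"]
  have "poly (M $ 1 $ 1) 1 = poly (M $ 2 $ 2) 0"
    using p_neq by (simp add: poly_pcompose spec_poly_values)
  with M12 M21 show ?thesis by (simp add: model_def)
qed

end

section \<open>The isomorphism with the model algebra\<close>

lemma eval_at_mult: "eval_at c (A ** B) = eval_at c A ** eval_at c B"
  by (intro matrix_eqI_2) (simp_all add: matrix_mult_nth_2)

lemma eval_at_add: "eval_at c (A + B) = eval_at c A + eval_at c B"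
  by (simp add: vec_eq_iff)

lemma eval_at_mat: "eval_at c (mat f) = mat (poly f c)"
  by (simp add: vec_eq_iff mat_nth)

lemma eval_at_smult: "eval_at c (smult_mpoly a M) = mat a ** eval_at c M"
  by (intro matrix_eqI_2) (simp_all add: smult_mpoly_def matrix_mult_nth_2 mat_nth)

definition model_alg :: "(complex, cmat_poly) module" where
  "model_alg = \<lparr>carrier = model, monoid.mult = (**), one = mat 1, ring.zero = 0, add = (+),
     module.smult = smult_mpoly\<rparr>"

lemma model_closed:
  "A \<in> model \<Longrightarrow> B \<in> model \<Longrightarrow> A ** B \<in> model"
  "A \<in> model \<Longrightarrow> B \<in> model \<Longrightarrow> A + B \<in> model"
  "A \<in> model \<Longrightarrow> smult_mpoly c A \<in> model"
  "mat 1 \<in> model"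
  by (auto simp: model_def matrix_mult_nth_2 smult_mpoly_def mat_nth)

context gegenbauer_pair
begin

definition represents :: "mop \<Rightarrow> cmat_poly \<Rightarrow> bool" where
  "represents D M \<longleftrightarrow> D \<in> diff_ops \<and> M \<in> model \<and>
     (\<forall>w. D (N w) = const_mpoly (eval_at (spec w) M) ** N w)"

lemma D_set_represents: "D \<in> D_set (weight p (p + q)) \<longleftrightarrow> (\<exists>M. represents D M)"
proof
  assume "D \<in> D_set (weight p (p + q))"
  then have D: "D \<in> diff_ops" and "\<forall>w. \<exists>L. D (N w) = const_mpoly L ** N w"
    by (simp_all add: D_set_iff)
  then obtain L where L: "\<And>w. D (N w) = const_mpoly (L w) ** N w" by metis
  obtain M where "\<And>w. L w = eval_at (spec w) M" using eigenvalue_polynomial[OF D L] by blast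
  with L eigenvalue_model[OF D] D show "\<exists>M. represents D M" unfolding represents_def by metis
next
  assume "\<exists>M. represents D M"
  then show "D \<in> D_set (weight p (p + q))" by (auto simp: D_set_iff represents_def)
qed

text \<open>The invertible leading coefficient of \<open>N w\<close> determines each eigenvalue, and
  the values at all \<open>spec w\<close> determine a polynomial.\<close>

lemma represents_unique:
  assumes "represents D M" "represents D M'"
  shows "M = M'"
proof -
  have "eval_at (spec w) M = eval_at (spec w) M'" for w
  proof -
    have "const_mpoly (eval_at (spec w) M) ** N w = const_mpoly (eval_at (spec w) M') ** N w"
      using assms by (metis represents_def)
    then have "eval_at (spec w) M ** N_lead w = eval_at (spec w) M' ** N_lead w"
      by (metis coeff_mpoly_const_mult coeff_mpoly_N_top)
    then show ?thesis by (metis matrix_mul_assoc N_lead_inverse(2) matrix_mul_rid)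
  qed
  then show ?thesis
    by (intro matrix_eqI_2 poly_eqI_spec) (metis eval_at_nth)+
qed

lemma represents_faithful:
  assumes "represents D M" "represents E M"
  shows "D = E"
proof (rule left_linear_ext[OF _ _ monic_Q])
  show lin: "left_linear D" "left_linear E"
    using assms by (auto simp: represents_def diff_ops_left_linear)
  show "D (Q w) = E (Q w)" for w
    using assms by (simp add: Q_def left_linear_const lin represents_def)
qed

text \<open>The order of factors is kept: \<open>E\<close> is applied second and passes the constant
  eigenvalue of \<open>D\<close> on its left.\<close>

lemma represents_mult:
  assumes "represents D M" "represents E M'"
  shows "represents (\<lambda>P. E (D P)) (M ** M')"
proof -
  have "left_linear E" using assms by (auto simp: represents_def diff_ops_left_linear)
  then show ?thesis
    using assms diff_ops_comp model_closed(1)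
    by (simp add: represents_def left_linear_const eval_at_mult const_mpoly_mult matrix_mul_assoc)
qed

lemma represents_add: "represents D M \<Longrightarrow> represents E M' \<Longrightarrow> represents (\<lambda>P. D P + E P) (M + M')"
  by (simp add: represents_def diff_ops_add model_closed eval_at_add const_mpoly_add matrix_add_rdistrib_2)

lemma represents_smult: "represents D M \<Longrightarrow> represents (\<lambda>P. smult_mpoly c (D P)) (smult_mpoly c M)"
  using diff_ops_const_left[of D c]
  by (simp add: represents_def model_closed eval_at_smult const_mpoly_mult matrix_mul_assoc)
     (simp add: smult_mpoly_eq matrix_mul_assoc)

lemma represents_one: "represents (\<lambda>P. P) (mat 1)"
  by (simp add: represents_def diff_ops_id model_closed eval_at_mat)

section \<open>Operators with prescribed eigenvalues\<close>

definition geg_mat :: "nat \<Rightarrow> cmat_poly" where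
  "geg_mat w = mat (geg w (p + q))"

text \<open>Horner's scheme: the step from \<open>f\<close> to \<open>pCons a f\<close> applies the
  operator with eigenvalue \<open>spec w\<close> once and adds the constant
  \<open>a\<close>.\<close>

lemma scalar_spectral_op:
  "\<exists>E\<in>diff_ops. \<forall>w. E (geg_mat w) = const_mpoly (mat (poly f (spec w))) ** geg_mat w"
proof (induction f)
  case 0
  have "const_mpoly (mat 0) ** A = 0" for A :: cmat_poly by (intro matrix_eqI_2) (simp_all add: matrix_mult_nth_2 mat_nth)
  then show ?case using diff_ops_0 by force
next
  case (pCons a f)
  then obtain E where E: "E \<in> diff_ops" "\<And>w. E (geg_mat w) = const_mpoly (mat (poly f (spec w))) ** geg_mat w"
    by blast
  define k where "k = complex_of_real q - of_real p"
  \<comment> \<open>The operator (x^2 - 1) y'' + (p + q + 2) x y' has eigenvalue w (w + p + q + 1);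
    adding q (p + 1) and dividing by q - p gives \<open>spec w\<close>.\<close>
  define F where "F = (\<lambda>i :: nat. if i = 0 then mat [:of_real q * (of_real p + 1) / k:]
      else if i = 1 then mat [:0, (of_real p + of_real q + 2) / k:] else mat [:- 1 / k, 0, 1 / k:] :: cmat_poly)"
  have k0: "k \<noteq> 0" using p_neq by (simp add: k_def)
  have d: "diff_op 2 F (geg_mat w) = const_mpoly (mat (spec w)) ** geg_mat w" for w
  proof -
    define y where "y = geg w (p + q)"
    have "y * [:of_real q * (of_real p + 1) / k:] + (pderiv y * [:0, (of_real p + of_real q + 2) / k:]
        + pderiv (pderiv y) * [:- 1 / k, 0, 1 / k:]) = [:spec w:] * y"
    proof (rule poly_eqI_points)
      fix x
      have "k * poly (y * [:of_real q * (of_real p + 1) / k:] + (pderiv y * [:0, (of_real p + of_real q + 2) / k:]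
        + pderiv (pderiv y) * [:- 1 / k, 0, 1 / k:])) x =
        of_real q * (of_real p + 1) * poly y x + (of_real p + of_real q + 2) * x * poly (pderiv y) x
         - (1 - x\<^sup>2) * poly (pderiv (pderiv y)) x"
        using k0 by (simp add: field_simps power2_eq_square)
      also have "\<dots> = k * spec w * poly y x"
        unfolding y_def poly_geg_ode[OF n_gt] k_def spec_eq by (simp add: algebra_simps)
      finally show "poly (y * [:of_real q * (of_real p + 1) / k:] + (pderiv y * [:0, (of_real p + of_real q + 2) / k:]
        + pderiv (pderiv y) * [:- 1 / k, 0, 1 / k:])) x = poly ([:spec w:] * y) x"
        using k0 by simp
    qed
    then show ?thesis
      by (intro matrix_eqI_2)
        (simp_all add: diff_op_def F_def geg_mat_def y_def numeral_2_eq_2 matrix_mult_nth_2 mat_nth add.assoc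
          del: mult_pCons_left mult_pCons_right)
  qed
  have "(\<lambda>P. const_mpoly (mat a) ** P + E (diff_op 2 F P)) \<in> diff_ops"
    by (rule diff_ops_add[OF diff_ops_const_left[OF diff_ops_id] diff_ops_comp[OF _ E(1)]]) (auto simp: diff_ops_def)
  moreover have "const_mpoly (mat a) ** geg_mat w + E (diff_op 2 F (geg_mat w)) =
      const_mpoly (mat (poly (pCons a f) (spec w))) ** geg_mat w" for w
    unfolding d left_linear_const[OF diff_ops_left_linear[OF E(1)]] E(2)
    by (intro matrix_eqI_2) (simp_all add: geg_mat_def matrix_mult_nth_2 mat_nth smult_add_left mult.commute)
  ultimately show ?case by (intro bexI[of _ "\<lambda>P. const_mpoly (mat a) ** P + E (diff_op 2 F P)"]) auto
qed

text \<open>Because \<open>geg_mat w\<close> is a scalar matrix, right multiplication by the matrix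
  units \<open>U i j\<close> assembles an arbitrary left eigenvalue from four scalar
  operators.\<close>

lemma matrix_spectral_op:
  "\<exists>E\<in>diff_ops. \<forall>w. E (geg_mat w) = const_mpoly (eval_at (spec w) C) ** geg_mat w"
proof -
  have "\<forall>f. \<exists>E. E \<in> diff_ops \<and> (\<forall>w. E (geg_mat w) = const_mpoly (mat (poly f (spec w))) ** geg_mat w)"
    using scalar_spectral_op by blast
  then obtain E where E: "\<And>f. E f \<in> diff_ops" "\<And>f w. E f (geg_mat w) = const_mpoly (mat (poly f (spec w))) ** geg_mat w"
    by metis
  define U :: "2 \<Rightarrow> 2 \<Rightarrow> cmat_poly" where "U = (\<lambda>i j. \<chi> k l. if k = i \<and> l = j then 1 else 0)"
  define G where "G = (\<lambda>P. (E (C $ 1 $ 1) P ** U 1 1 + E (C $ 1 $ 2) P ** U 1 2)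
     + (E (C $ 2 $ 1) P ** U 2 1 + E (C $ 2 $ 2) P ** U 2 2))"
  have "G \<in> diff_ops" unfolding G_def by (intro diff_ops_add diff_ops_mult_right E(1))
  moreover have "G (geg_mat w) = const_mpoly (eval_at (spec w) C) ** geg_mat w" for w
    unfolding G_def E(2)
    by (intro matrix_eqI_2) (simp_all add: U_def geg_mat_def matrix_mult_nth_2 mat_nth)
  ultimately show ?thesis by blast
qed

text \<open>The constants q + 1 and p + 1 make the off-diagonal entries cancel on
  \<open>N w\<close>; the diagonal entries become Gegenbauer operators applied to y_w.\<close>

definition lower_op :: mop where
  "lower_op = diff_op 1 (\<lambda>i. if i = 0 then diag2 [:of_real q + 1:] [:of_real p + 1:]
     else vector [vector [[:0, 1:], -1], vector [-1, [:0, 1:]]])"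

definition raise_op :: mop where
  "raise_op = diff_op 1 (\<lambda>i. if i = 0 then diag2 [:of_real p:] [:of_real q:]
     else vector [vector [[:0, 1:], 1], vector [1, [:0, 1:]]])"

lemma raise_op_geg: "raise_op (geg_mat w) = N w"
  by (intro matrix_eqI_2)
     (simp_all add: raise_op_def diff_op_def geg_mat_def N_def lift_nth matrix_mult_nth_2 mat_nth)

lemma lower_op_N:
  "lower_op (N w) = const_mpoly (mat (of_real q - of_real p) ** diag2 (spec w - 1) (spec w)) ** geg_mat w"
proof -
  define y where "y = geg w (p + q)"
  have ode: "(1 - x\<^sup>2) * poly (pderiv (pderiv y)) x = (of_real p + of_real q + 2) * x * poly (pderiv y) x
      - of_nat w * (of_nat w + of_real p + of_real q + 1) * poly y x" for x
    unfolding y_def poly_geg_ode[OF n_gt] by (simp add: add_ac)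
  have s: "(of_real q - of_real p) * spec w = (of_nat w + of_real p + 1) * (of_nat w + of_real q)" by (rule spec_eq)
  \<comment> \<open>The companion factorisation, which holds because (w + p + 1)(w + q) exceeds (w +
    p)(w + q + 1) by q - p.\<close>
  have s1: "(of_real q - of_real p) * (spec w - 1) = (of_nat w + of_real p) * (of_nat w + of_real q + 1)"
    using s by (simp add: algebra_simps)
  have expand: "lower_op A $ i $ 1 = A $ i $ 1 * [:of_real q + 1:] + [:0, 1:] * pderiv (A $ i $ 1) - pderiv (A $ i $ 2)"
    "lower_op A $ i $ 2 = A $ i $ 2 * [:of_real p + 1:] + [:0, 1:] * pderiv (A $ i $ 2) - pderiv (A $ i $ 1)" for A i
    by (simp_all add: lower_op_def diff_op_def matrix_mult_nth_2 algebra_simps del: mult_pCons_left mult_pCons_right)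
  have "lower_op (N w) $ 1 $ 1 = [:(of_real q - of_real p) * (spec w - 1):] * y"
  proof (rule poly_eqI_points)
    fix x
    have "poly (lower_op (N w) $ 1 $ 1) x = (of_real q + 1) * of_real p * poly y x
       + (of_real p + of_real q + 2) * x * poly (pderiv y) x - (1 - x\<^sup>2) * poly (pderiv (pderiv y)) x"
      unfolding expand N_def lift_nth y_def[symmetric]
      by (simp add: pderiv_simps algebra_simps power2_eq_square)
    then show "poly (lower_op (N w) $ 1 $ 1) x = poly ([:(of_real q - of_real p) * (spec w - 1):] * y) x"
      unfolding ode s1 by (simp add: algebra_simps)
  qed
  moreover have "lower_op (N w) $ 2 $ 2 = [:(of_real q - of_real p) * spec w:] * y"
  proof (rule poly_eqI_points)
    fix x
    have "poly (lower_op (N w) $ 2 $ 2) x = (of_real p + 1) * of_real q * poly y x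
       + (of_real p + of_real q + 2) * x * poly (pderiv y) x - (1 - x\<^sup>2) * poly (pderiv (pderiv y)) x"
      unfolding expand N_def lift_nth y_def[symmetric]
      by (simp add: pderiv_simps algebra_simps power2_eq_square)
    then show "poly (lower_op (N w) $ 2 $ 2) x = poly ([:(of_real q - of_real p) * spec w:] * y) x"
      unfolding ode s by (simp add: algebra_simps)
  qed
  moreover have "lower_op (N w) $ 1 $ 2 = 0" "lower_op (N w) $ 2 $ 1 = 0"
    unfolding expand N_def lift_nth y_def[symmetric]
    by (rule poly_eqI_points; simp add: pderiv_simps algebra_simps)+
  ultimately show ?thesis
    by (intro matrix_eqI_2)
       (simp_all add: matrix_mult_nth_2 mat_nth geg_mat_def y_def del: mult_pCons_left)
qed

text \<open>By the factor theorem \<open>M\<close> is a scalar \<open>a\<close> plus diag(t - 1, t)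
  \<open>C\<close>. The second summand is realised by going down to y_w, applying the operator for
  \<open>C\<close>, and coming back.\<close>

lemma represents_exists:
  assumes M: "M \<in> model"
  shows "\<exists>D. represents D M"
proof -
  define a where "a = poly (M $ 1 $ 1) 1"
  have root: "\<exists>g. f = [:b:] + [:- c, 1:] * g" if "poly f c = b" for f :: "complex poly" and b c
  proof -
    have "poly (f - [:b:]) c = 0" using that by simp
    then obtain g where "f - [:b:] = [:- c, 1:] * g" unfolding poly_eq_0_iff_dvd by (rule dvdE)
    then show ?thesis by (intro exI[of _ g]) (simp only: diff_eq_eq add.commute)
  qed
  obtain c11 where c11: "M $ 1 $ 1 = [:a:] + [:-1, 1:] * c11" using root[of "M $ 1 $ 1" 1 a] by (auto simp: a_def)
  obtain c12 where c12: "M $ 1 $ 2 = [:0:] + [:-1, 1:] * c12" using root[of "M $ 1 $ 2" 1 0] M by (auto simp: model_def)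
  obtain c21 where c21: "M $ 2 $ 1 = [:0:] + [:-0, 1:] * c21" using root[of "M $ 2 $ 1" 0 0] M by (auto simp: model_def)
  obtain c22 where c22: "M $ 2 $ 2 = [:a:] + [:-0, 1:] * c22" using root[of "M $ 2 $ 2" 0 a] M by (auto simp: model_def a_def)
  define C :: cmat_poly where "C = vector [vector [c11, c12], vector [c21, c22]]"
  have C: "C $ 1 $ 1 = c11" "C $ 1 $ 2 = c12" "C $ 2 $ 1 = c21" "C $ 2 $ 2 = c22" by (simp_all add: C_def)
  define k where "k = complex_of_real q - of_real p"
  obtain E where E: "E \<in> diff_ops" "\<And>w. E (geg_mat w) = const_mpoly (eval_at (spec w) C) ** geg_mat w"
    using matrix_spectral_op by blast
  have ops: "lower_op \<in> diff_ops" "raise_op \<in> diff_ops" by (auto simp: lower_op_def raise_op_def diff_ops_def)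
  \<comment> \<open>The factor 1 / \<open>k\<close> removes the q - p that \<open>lower_op\<close>
    introduces.\<close>
  define D where "D = (\<lambda>P. const_mpoly (mat a) ** P + const_mpoly (mat (1 / k)) ** raise_op (E (lower_op P)))"
  have "D \<in> diff_ops" unfolding D_def
    by (rule diff_ops_add[OF diff_ops_const_left[OF diff_ops_id]
          diff_ops_const_left[OF diff_ops_comp[OF diff_ops_comp[OF ops(1) E(1)] ops(2)]]])
  moreover have "D (N w) = const_mpoly (eval_at (spec w) M) ** N w" for w
  proof -
    note lin = left_linear_const[OF diff_ops_left_linear]
    have "D (N w) = const_mpoly (mat a + mat (1 / k) ** (mat k ** diag2 (spec w - 1) (spec w)) ** eval_at (spec w) C) ** N w"
      unfolding D_def lower_op_N lin[OF E(1)] E(2) lin[OF ops(2)] raise_op_geg k_def[symmetric]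
      by (simp only: const_mpoly_add const_mpoly_mult matrix_add_rdistrib_2 matrix_mul_assoc)
    also have "mat a + mat (1 / k) ** (mat k ** diag2 (spec w - 1) (spec w)) ** eval_at (spec w) C = eval_at (spec w) M"
      using p_neq(3) unfolding k_def[symmetric]
      by (intro matrix_eqI_2) (simp_all add: matrix_mult_nth_2 mat_nth c11 c12 c21 c22 C algebra_simps)
    finally show ?thesis .
  qed
  ultimately show ?thesis using M unfolding represents_def by blast
qed

section \<open>Assembling the isomorphism\<close>

lemma D_alg_iso_model:
  obtains h where "h \<in> alg_iso (D_alg (weight p (p + q))) model_alg"
proof
  define h where "h = (\<lambda>D. THE M. represents D M)"
  have h: "h D = M" if "represents D M" for D M
    unfolding h_def using that represents_unique by blast
  have car: "carrier (D_alg (weight p (p + q))) = {D. \<exists>M. represents D M}"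
    using D_set_represents by (auto simp: D_alg_def)
  have model: "h D \<in> model" if "represents D M" for D M
    using that h[OF that] by (simp add: represents_def)
  have inj: "D = E" if "represents D M" "represents E M'" "h D = h E" for D E M M'
    using that h represents_faithful by metis
  show "h \<in> alg_iso (D_alg (weight p (p + q))) model_alg"
    unfolding alg_iso_def
  proof (intro CollectI conjI ballI allI ring_iso_memI, unfold car)
    show "bij_betw h {D. \<exists>M. represents D M} (carrier model_alg)"
      unfolding bij_betw_def
    proof (intro conjI inj_onI equalityI subsetI)
      show "D = E" if "D \<in> {D. \<exists>M. represents D M}" "E \<in> {D. \<exists>M. represents D M}" "h D = h E" for D E
        using that inj by blast
      show "M \<in> carrier model_alg" if "M \<in> h ` {D. \<exists>M. represents D M}" for M
        using that model by (auto simp: model_alg_def)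
      show "M \<in> h ` {D. \<exists>M. represents D M}" if M: "M \<in> carrier model_alg" for M
      proof -
        have "M \<in> model" using M by (simp add: model_alg_def)
        then obtain D where D: "represents D M" using represents_exists by blast
        show ?thesis using h[OF D, symmetric] D by blast
      qed
    qed
  next
    fix D E assume "D \<in> {D. \<exists>M. represents D M}" "E \<in> {D. \<exists>M. represents D M}"
    then obtain M M' where D: "represents D M" "represents E M'" by blast
    show "h (D \<otimes>\<^bsub>D_alg (weight p (p + q))\<^esub> E) = h D \<otimes>\<^bsub>model_alg\<^esub> h E"
      using h[OF represents_mult[OF D]] h[OF D(1)] h[OF D(2)] by (simp add: D_alg_def model_alg_def)
    show "h (D \<oplus>\<^bsub>D_alg (weight p (p + q))\<^esub> E) = h D \<oplus>\<^bsub>model_alg\<^esub> h E"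
      using h[OF represents_add[OF D]] h[OF D(1)] h[OF D(2)] by (simp add: D_alg_def model_alg_def)
  next
    show "h \<one>\<^bsub>D_alg (weight p (p + q))\<^esub> = \<one>\<^bsub>model_alg\<^esub>"
      using h[OF represents_one] by (simp add: D_alg_def model_alg_def)
  next
    fix D assume "D \<in> {D. \<exists>M. represents D M}"
    then obtain M where D: "represents D M" by blast
    show "h D \<in> carrier model_alg" using model[OF D] by (simp add: model_alg_def)
    show "h (c \<odot>\<^bsub>D_alg (weight p (p + q))\<^esub> D) = c \<odot>\<^bsub>model_alg\<^esub> h D" for c
      using h[OF represents_smult[OF D]] h[OF D] by (simp add: D_alg_def model_alg_def)
  qed
qed

text \<open>\<open>D_alg\<close> is a bare record, so closure is established from the representation
  by \<open>model\<close>; inverting an isomorphism relies on it.\<close>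

lemma D_alg_closed:
  "D \<in> carrier (D_alg (weight p (p + q))) \<Longrightarrow> E \<in> carrier (D_alg (weight p (p + q))) \<Longrightarrow>
     D \<otimes>\<^bsub>D_alg (weight p (p + q))\<^esub> E \<in> carrier (D_alg (weight p (p + q)))"
  "D \<in> carrier (D_alg (weight p (p + q))) \<Longrightarrow> E \<in> carrier (D_alg (weight p (p + q))) \<Longrightarrow>
     D \<oplus>\<^bsub>D_alg (weight p (p + q))\<^esub> E \<in> carrier (D_alg (weight p (p + q)))"
  "D \<in> carrier (D_alg (weight p (p + q))) \<Longrightarrow>
     c \<odot>\<^bsub>D_alg (weight p (p + q))\<^esub> D \<in> carrier (D_alg (weight p (p + q)))"
  "\<one>\<^bsub>D_alg (weight p (p + q))\<^esub> \<in> carrier (D_alg (weight p (p + q)))"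
  unfolding D_alg_def monoid.simps ring.simps module.simps partial_object.simps D_set_represents
  using represents_mult represents_add represents_smult represents_one by fast+

end

text \<open>The isomorphism is \<open>f\<close> followed by the inverse of \<open>g\<close>.\<close>

lemma alg_isomorphic_common_target:
  assumes f: "f \<in> alg_iso A C" and g: "g \<in> alg_iso B C"
    and mult: "\<And>x y. x \<in> carrier B \<Longrightarrow> y \<in> carrier B \<Longrightarrow> x \<otimes>\<^bsub>B\<^esub> y \<in> carrier B"
    and add: "\<And>x y. x \<in> carrier B \<Longrightarrow> y \<in> carrier B \<Longrightarrow> x \<oplus>\<^bsub>B\<^esub> y \<in> carrier B"
    and smult: "\<And>c x. x \<in> carrier B \<Longrightarrow> c \<odot>\<^bsub>B\<^esub> x \<in> carrier B"
    and one: "\<one>\<^bsub>B\<^esub> \<in> carrier B"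
    and A_mult: "\<And>x y. x \<in> carrier A \<Longrightarrow> y \<in> carrier A \<Longrightarrow> x \<otimes>\<^bsub>A\<^esub> y \<in> carrier A"
    and A_add: "\<And>x y. x \<in> carrier A \<Longrightarrow> y \<in> carrier A \<Longrightarrow> x \<oplus>\<^bsub>A\<^esub> y \<in> carrier A"
    and A_smult: "\<And>c x. x \<in> carrier A \<Longrightarrow> c \<odot>\<^bsub>A\<^esub> x \<in> carrier A"
    and A_one: "\<one>\<^bsub>A\<^esub> \<in> carrier A"
  shows "alg_isomorphic A B"
proof -
  have fi: "f \<in> ring_iso A C" and fs: "\<And>c x. x \<in> carrier A \<Longrightarrow> f (c \<odot>\<^bsub>A\<^esub> x) = c \<odot>\<^bsub>C\<^esub> f x"
    and gi: "g \<in> ring_iso B C" and gs: "\<And>c x. x \<in> carrier B \<Longrightarrow> g (c \<odot>\<^bsub>B\<^esub> x) = c \<odot>\<^bsub>C\<^esub> g x"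
    using f g by (auto simp: alg_iso_def)
  note F = ring_iso_memE[OF fi] and G = ring_iso_memE[OF gi]
  define h where "h = inv_into (carrier B) g \<circ> f"
  have h: "h x \<in> carrier B" "g (h x) = f x" if "x \<in> carrier A" for x
  proof -
    have "f x \<in> g ` carrier B" using F(1)[OF that] bij_betw_imp_surj_on[OF G(5)] by simp
    then show "h x \<in> carrier B" "g (h x) = f x" by (simp_all add: h_def inv_into_into f_inv_into_f)
  qed
  have inj: "x = y" if "x \<in> carrier B" "y \<in> carrier B" "g x = g y" for x y
    using that bij_betw_imp_inj_on[OF G(5)] by (meson inj_onD)
  have "h \<in> alg_iso A B"
    unfolding alg_iso_def
  proof (intro CollectI conjI ballI allI ring_iso_memI)
    show "bij_betw h (carrier A) (carrier B)"
      unfolding h_def by (rule bij_betw_trans[OF F(5) bij_betw_inv_into[OF G(5)]])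
  \<comment> \<open>Each compatibility law is checked after applying \<open>g\<close>; closure of
    the carriers lets injectivity of \<open>g\<close> transfer it back.\<close>
  qed (fact h(1) | rule inj; simp add: h F G fs gs mult add smult one A_mult A_add A_smult A_one)+
  then show ?thesis by (auto simp: alg_isomorphic_def)
qed

theorem theorem5p4:
  fixes n p n' p' :: real
  assumes "0 < p" "p < n / 2" "0 < p'" "p' < n' / 2"
  shows "alg_isomorphic (D_alg (weight p n)) (D_alg (weight p' n'))"
proof -
  interpret A: gegenbauer_pair p "n - p" using assms by unfold_locales auto
  interpret B: gegenbauer_pair p' "n' - p'" using assms by unfold_locales auto
  have n: "p + (n - p) = n" "p' + (n' - p') = n'" by simp_all
  obtain f g where "f \<in> alg_iso (D_alg (weight p n)) model_alg" "g \<in> alg_iso (D_alg (weight p' n')) model_alg"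
    using A.D_alg_iso_model B.D_alg_iso_model unfolding n by metis
  then show ?thesis
    by (rule alg_isomorphic_common_target)
       (fact A.D_alg_closed[unfolded n] B.D_alg_closed[unfolded n])+
qed

end
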